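(* Let $\sigma>0$, let $\Phi:\Theta\to\mathbb{R}$ be a $\mathcal{C}^1$ functional, let $V$ be a $\mathcal{C}^1$ vector field over $\Theta$, let $\chi_n:\Theta\to[0,1]$ be a sequence of $\mathcal{C}^1$ functions with compact supports, let $\hat\Psi_0$ be an estimator (a real-valued $X^n$-measurable random variable), and put $Z_n=\sqrt n(\Phi-\hat\Psi_0)$ and $\hat\Phi=\Phi+n^{-1}\langle V|\nabla\ell_n\rangle$ (a random functional on $\Theta$). Then, whenever $\Pi_n[\chi_n]>0$, $$d_{BL}\left(\Pi_n\circ Z_n^{-1},\mathcal{N}(0,\sigma^2)\right)\le \sigma^{-1}\sqrt{2n\pi}\;\Pi_n^{\chi_n}\left[\left|\hat\Phi-\hat\Psi_0+\frac1n\mathrm{Div}_\pi V\right|\right]+4\sigma^{-2}\,\Pi_n^{\chi_n}\left[\left|\sigma^2-\langle\nabla\Phi|V\rangle\right|\right]+\sigma^{-1}\sqrt{\frac{2\pi}{n}}\;\frac{\Pi_n\left[|\langle\nabla\chi_n|V\rangle|\right]}{\Pi_n[\chi_n]}+2\,\Pi_n[1-\chi_n].$$ Here, in the factors $\sqrt{2n\pi}$ and $\sqrt{2\pi/n}$, $\pi$ is the number $3.14\ldots$, while in $\mathrm{Div}_\pi$ it is the prior density.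
   Context: Setting. $\{P_\theta:\theta\in\Theta\}$ is a statistical model on a measurable space, dominated by a measure $\lambda$, where $\Theta$ is a manifold without boundary of finite dimension $p$. Write $\ell(\theta,x)=\ln\frac{dP_\theta}{d\lambda}(x)$, assumed $\mathcal{C}^1$ in $\theta$. $\Theta$ carries the Fisher information metric, given in local coordinates by $g_{\mu\nu}(\theta)=\int(\partial_\mu\ell)(\partial_\nu\ell)\,dP_\theta$, assumed to be a well-defined (smooth) Riemannian metric; $\langle\cdot|\cdot\rangle$, $\nabla$, $\mathrm{Div}$, $\mathrm{vol}_\Theta$ are the associated inner product, gradient, divergence and Riemannian volume. The model, $\Theta$, $p$, the prior, $\Phi$, $\hat\Psi_0$ and $V$ may all depend on $n$. Prior and posterior. $\Pi$ is a (possibly improper) measure on $\Theta$ with an everywhere positive $\mathcal{C}^1$ density $\pi$ with respect to $\mathrm{vol}_\Theta$. For data $X^n=(X_1,\dots,X_n)$, $\ell_n(\theta)=\sum_{i=1}^n\ell(\theta,X_i)$; it is assumed that $e^{\ell_n}\in L^1(\Pi)$, and the posterior is $\Pi_n(d\theta)=e^{\ell_n(\theta)}\Pi(d\theta)/\int e^{\ell_n}d\Pi$. For a measure $\mu$ and a function $f$, $\mu[f]=\int f\,d\mu$. For $\chi\ge0$ with $\Pi_n[\chi]>0$, $\Pi_n^\chi[f]=\Pi_n[\chi f]/\Pi_n[\chi]$. The weighted divergence is $\mathrm{Div}_\pi V=\mathrm{Div}V+\langle V|\nabla\ln\pi\rangle$. $\Pi_n\circ Z_n^{-1}$ is the law of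 $Z_n(\theta)$ when $\theta\sim\Pi_n$ (with $X^n$ fixed). Bounded Lipschitz distance: for probability measures $\mu,\nu$ on $\mathbb{R}$, $d_{BL}(\mu,\nu)=\sup\{|\int h\,d(\mu-\nu)|:\ h:\mathbb{R}\to[-1,1],\ |h(x)-h(y)|\le|x-y|\ \forall x,y\}$. *)

theory Defs
  imports "HOL-Probability.Probability"
begin

section \<open>Functions of class \<open>C\<^sup>k\<close> on an open subset of a normed space\<close>

primrec Ck_on ::
  "nat \<Rightarrow> 'e::real_normed_vector set \<Rightarrow> ('e \<Rightarrow> 'f::real_normed_vector) \<Rightarrow> bool"
where
  "Ck_on 0 S f \<longleftrightarrow> continuous_on S f"
| "Ck_on (Suc k) S f \<longleftrightarrow>
     (\<forall>x\<in>S. f differentiable at x) \<and> (\<forall>v. Ck_on k S (\<lambda>x. frechet_derivative f (at x) v))"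

definition smooth_on :: "'e::real_normed_vector set \<Rightarrow> ('e \<Rightarrow> 'f::real_normed_vector) \<Rightarrow> bool"
  where "smooth_on S f \<longleftrightarrow> (\<forall>k. Ck_on k S f)"


section \<open>Manifolds\<close>

text \<open>
  The manifold is a whole (Hausdorff, second countable) topological type, with a smooth atlas whose
  charts take values in open subsets of \<open>real ^ 'p\<close>; its dimension is \<open>CARD('p)\<close>.
  A chart is a pair of its domain and its coordinate map; the values of the coordinate map outside
  the domain are irrelevant.
\<close>

type_synonym ('a, 'p) chart = "'a set \<times> ('a \<Rightarrow> real ^ 'p)"

definition chart_inv :: "('a, 'p) chart \<Rightarrow> real ^ 'p \<Rightarrow> 'a"
  where "chart_inv c = inv_into (fst c) (snd c)"

definition is_chart :: "('a::topological_space, 'p::finite) chart \<Rightarrow> bool"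
  where "is_chart c \<longleftrightarrow>
    open (fst c) \<and> open (snd c ` fst c) \<and>
    homeomorphism (fst c) (snd c ` fst c) (snd c) (chart_inv c)"

definition transition :: "('a, 'p) chart \<Rightarrow> ('a, 'p) chart \<Rightarrow> real ^ 'p \<Rightarrow> real ^ 'p"
  where "transition c d = snd d \<circ> chart_inv c"

definition smooth_atlas :: "('a::topological_space, 'p::finite) chart set \<Rightarrow> bool"
  where "smooth_atlas A \<longleftrightarrow>
    (\<forall>c\<in>A. is_chart c) \<and> (\<Union>c\<in>A. fst c) = UNIV \<and>
    (\<forall>c\<in>A. \<forall>d\<in>A. smooth_on (snd c ` (fst c \<inter> fst d)) (transition c d))"

definition chart_at :: "('a, 'p) chart set \<Rightarrow> 'a \<Rightarrow> ('a, 'p) chart"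
  where "chart_at A \<theta> = (SOME c. c \<in> A \<and> \<theta> \<in> fst c)"

definition C1_function :: "('a, 'p::finite) chart set \<Rightarrow> ('a \<Rightarrow> real) \<Rightarrow> bool"
  where "C1_function A f \<longleftrightarrow> (\<forall>c\<in>A. Ck_on 1 (snd c ` fst c) (f \<circ> chart_inv c))"

text \<open>The vector of the partial derivatives \<open>\<partial>\<^sub>\<mu> f\<close> at \<open>\<theta>\<close> in the local coordinates \<open>c\<close>.\<close>

definition coord_deriv :: "('a, 'p::finite) chart \<Rightarrow> ('a \<Rightarrow> real) \<Rightarrow> 'a \<Rightarrow> real ^ 'p"
  where "coord_deriv c f \<theta> =
    (\<chi> \<mu>. frechet_derivative (f \<circ> chart_inv c) (at (snd c \<theta>)) (axis \<mu> 1))"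

text \<open>
  A vector field is given by its components in the charts: \<open>V c \<theta> $ \<mu>\<close> is the component \<open>V\<^sup>\<mu>(\<theta>)\<close> in
  the chart \<open>c\<close>, for \<open>\<theta>\<close> in the domain of \<open>c\<close>. Components in different charts are related by the
  derivative of the transition map, which makes such a family a section of the tangent bundle.
\<close>

type_synonym ('a, 'p) field_components = "('a, 'p) chart \<Rightarrow> 'a \<Rightarrow> real ^ 'p"

definition vector_field :: "('a, 'p::finite) chart set \<Rightarrow> ('a, 'p) field_components \<Rightarrow> bool"
  where "vector_field A V \<longleftrightarrow>
    (\<forall>c\<in>A. \<forall>d\<in>A. \<forall>\<theta>\<in>fst c \<inter> fst d.
       V d \<theta> = frechet_derivative (transition c d) (at (snd c \<theta>)) (V c \<theta>))"

definition C1_vector_field :: "('a, 'p::finite) chart set \<Rightarrow> ('a, 'p) field_components \<Rightarrow> bool"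
  where "C1_vector_field A V \<longleftrightarrow>
    vector_field A V \<and> (\<forall>c\<in>A. Ck_on 1 (snd c ` fst c) (V c \<circ> chart_inv c))"


section \<open>Riemannian metrics\<close>

text \<open>\<open>g c \<theta> $ \<mu> $ \<nu>\<close> is the coefficient \<open>g\<^sub>\<mu>\<^sub>\<nu>(\<theta>)\<close> in the chart \<open>c\<close>.\<close>

type_synonym ('a, 'p) metric_components = "('a, 'p) chart \<Rightarrow> 'a \<Rightarrow> real ^ 'p ^ 'p"

definition riemannian_metric :: "('a, 'p::finite) chart set \<Rightarrow> ('a, 'p) metric_components \<Rightarrow> bool"
  where "riemannian_metric A g \<longleftrightarrow>
    (\<forall>c\<in>A. \<forall>\<theta>\<in>fst c.
       transpose (g c \<theta>) = g c \<theta> \<and> (\<forall>v. v \<noteq> 0 \<longrightarrow> v \<bullet> (g c \<theta> *v v) > 0)) \<and>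
    (\<forall>c\<in>A. \<forall>d\<in>A. \<forall>\<theta>\<in>fst c \<inter> fst d. \<forall>v w.
       let T = frechet_derivative (transition c d) (at (snd c \<theta>))
       in T v \<bullet> (g d \<theta> *v T w) = v \<bullet> (g c \<theta> *v w)) \<and>
    (\<forall>c\<in>A. \<forall>\<mu> \<nu>. smooth_on (snd c ` fst c) (\<lambda>y. g c (chart_inv c y) $ \<mu> $ \<nu>))"

text \<open>
  The next three notions are given by local formulas whose values do not depend on the chart.
  Where a value at a point is needed, it is computed in some chart of the atlas around that point.
\<close>

definition riem_inner ::
  "('a, 'p::finite) chart set \<Rightarrow> ('a, 'p) metric_components \<Rightarrow>
   ('a, 'p) field_components \<Rightarrow> ('a, 'p) field_components \<Rightarrow> 'a \<Rightarrow> real"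
  where "riem_inner A g V W \<theta> = (let c = chart_at A \<theta> in V c \<theta> \<bullet> (g c \<theta> *v W c \<theta>))"

text \<open>\<open>(\<nabla>f)\<^sup>\<mu> = g\<^sup>\<mu>\<^sup>\<nu> \<partial>\<^sub>\<nu> f\<close>\<close>

definition gradient ::
  "('a, 'p::finite) metric_components \<Rightarrow> ('a \<Rightarrow> real) \<Rightarrow> ('a, 'p) field_components"
  where "gradient g f = (\<lambda>c \<theta>. matrix_inv (g c \<theta>) *v coord_deriv c f \<theta>)"

text \<open>\<open>Div V = |g|\<^sup>-\<^sup>1\<^sup>/\<^sup>2 \<partial>\<^sub>\<mu>(|g|\<^sup>1\<^sup>/\<^sup>2 V\<^sup>\<mu>)\<close>\<close>

definition divergence ::
  "('a, 'p::finite) chart set \<Rightarrow> ('a, 'p) metric_components \<Rightarrow>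
   ('a, 'p) field_components \<Rightarrow> 'a \<Rightarrow> real"
  where "divergence A g V \<theta> = (let c = chart_at A \<theta> in
    (\<Sum>\<mu>\<in>UNIV. coord_deriv c (\<lambda>t. sqrt (det (g c t)) * V c t $ \<mu>) \<theta> $ \<mu>) / sqrt (det (g c \<theta>)))"

definition weighted_divergence ::
  "('a, 'p::finite) chart set \<Rightarrow> ('a, 'p) metric_components \<Rightarrow> ('a \<Rightarrow> real) \<Rightarrow>
   ('a, 'p) field_components \<Rightarrow> 'a \<Rightarrow> real"
  where "weighted_divergence A g w V \<theta> =
    divergence A g V \<theta> + riem_inner A g V (gradient g (\<lambda>t. ln (w t))) \<theta>"

text \<open>
  The Riemannian volume is the unique Borel measure that is \<open>|g|\<^sup>1\<^sup>/\<^sup>2 dy\<close> in the coordinates of every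
  chart.
\<close>

definition riemannian_volume ::
  "('a::topological_space, 'p::finite) chart set \<Rightarrow> ('a, 'p) metric_components \<Rightarrow>
   'a measure \<Rightarrow> bool"
  where "riemannian_volume A g vol \<longleftrightarrow>
    sets vol = sets borel \<and>
    (\<forall>c\<in>A. \<forall>B\<in>sets borel. B \<subseteq> fst c \<longrightarrow>
       emeasure vol B = (\<integral>\<^sup>+y\<in>snd c ` B. ennreal (sqrt (det (g c (chart_inv c y)))) \<partial>lborel))"


section \<open>Statistical models and posteriors\<close>

definition fisher_metric ::
  "('a \<Rightarrow> 'x measure) \<Rightarrow> ('a \<Rightarrow> 'x \<Rightarrow> real) \<Rightarrow> ('a, 'p::finite) metric_components"
  where "fisher_metric P l = (\<lambda>c \<theta>. \<chi> \<mu> \<nu>.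
    (\<integral>x. coord_deriv c (\<lambda>t. l t x) \<theta> $ \<mu> * coord_deriv c (\<lambda>t. l t x) \<theta> $ \<nu> \<partial>P \<theta>))"

definition fisher_integrable ::
  "('a, 'p::finite) chart set \<Rightarrow> ('a \<Rightarrow> 'x measure) \<Rightarrow> ('a \<Rightarrow> 'x \<Rightarrow> real) \<Rightarrow> bool"
  where "fisher_integrable A P l \<longleftrightarrow> (\<forall>c\<in>A. \<forall>\<theta>\<in>fst c. \<forall>\<mu> \<nu>.
    integrable (P \<theta>)
      (\<lambda>x. coord_deriv c (\<lambda>t. l t x) \<theta> $ \<mu> * coord_deriv c (\<lambda>t. l t x) \<theta> $ \<nu>))"

definition log_likelihood ::
  "nat \<Rightarrow> ('a \<Rightarrow> 'x \<Rightarrow> real) \<Rightarrow> (nat \<Rightarrow> 'x) \<Rightarrow> 'a \<Rightarrow> real"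
  where "log_likelihood n l X \<theta> = (\<Sum>i=1..n. l \<theta> (X i))"

definition posterior :: "'a measure \<Rightarrow> ('a \<Rightarrow> real) \<Rightarrow> 'a measure"
  where "posterior Prior L =
    density Prior (\<lambda>\<theta>. ennreal (exp (L \<theta>) / (\<integral>t. exp (L t) \<partial>Prior)))"

definition localized_expectation :: "'a measure \<Rightarrow> ('a \<Rightarrow> real) \<Rightarrow> ('a \<Rightarrow> real) \<Rightarrow> real"
  where "localized_expectation M chi f = (\<integral>\<theta>. chi \<theta> * f \<theta> \<partial>M) / (\<integral>\<theta>. chi \<theta> \<partial>M)"

definition d_BL :: "real measure \<Rightarrow> real measure \<Rightarrow> real"
  where "d_BL M N =
    (SUP h\<in>{h :: real \<Rightarrow> real. (\<forall>x. h x \<in> {-1..1}) \<and> (\<forall>x y. \<bar>h x - h y\<bar> \<le> \<bar>x - y\<bar>)}.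
       \<bar>(\<integral>x. h x \<partial>M) - (\<integral>x. h x \<partial>N)\<bar>)"

end

theory Submission
  imports Defs
begin

text \<open>
  Stein's method combined with an integration by parts on \<open>\<Theta>\<close>. For a bounded Lipschitz \<open>h\<close>, the
  solution \<open>f\<close> of \<open>\<sigma>\<^sup>2 f' - z f = h - N(h)\<close> satisfies \<open>\<bar>f\<bar> \<le> \<surd>(2\<pi>) / \<sigma>\<close> and \<open>\<bar>f'\<bar> \<le> 4 / \<sigma>\<^sup>2\<close>.
  The divergence theorem for the compactly supported field \<open>\<chi> f(Z) V\<close>, weighted by the posterior
  density, gives
  \<open>\<Pi>\<^sub>n[\<chi> f'(Z) \<langle>\<nabla>\<Phi>|V\<rangle>] = - \<Pi>\<^sub>n[\<chi> f(Z) \<surd>n (\<Phi>_hat - \<Phi> + Div V / n)] - \<Pi>\<^sub>n[f(Z) \<langle>\<nabla>\<chi>|V\<rangle>] / \<surd>n\<close>,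
  with the divergence weighted by the prior density. Inserted into the expectation of Stein's
  equation under the localized posterior, this leaves the three localized terms of the bound; passing
  from the localized posterior to the posterior costs \<open>2 \<Pi>\<^sub>n[1 - \<chi>]\<close>.
\<close>

section \<open>The Stein equation of a centred normal law\<close>

text \<open>The constants come from two Gaussian tail estimates. Let \<open>k = h - N(h)\<close>,
  which is bounded by 2, and let \<open>p\<close> be the normal density. Multiplied by
  \<open>p\<close>, Stein's equation reads \<open>(\<sigma>\<^sup>2 p f)' = k p\<close>. The mass of
  the tail beyond \<open>|x|\<close> is at most \<open>sqrt (2 * pi) * \<sigma> / 2 * p(x)\<close>,
  which bounds \<open>f\<close>; and \<open>|x|\<close> times that mass is at most
  \<open>\<sigma>\<^sup>2 p(x)\<close>, which gives \<open>|x f(x)| \<le> 2\<close> and hence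
  \<open>|f'| \<le> (2 + 2) / \<sigma>\<^sup>2\<close>. For a Lipschitz \<open>h\<close> the
  solution is C1 and in general not C2, and \<open>\<chi>\<close> and \<open>V\<close> are C1 as
  well, so all calculus on the manifold runs at order one. The geometric obstacle is that the
  divergence at a point is computed in whichever chart \<open>chart_at\<close> picks there, possibly
  another one at every point. A divergence theorem proved inside one chart speaks about that
  divergence only once its value is known not to depend on the chart. The 2 in front of the mass of
  \<open>1 - \<chi>\<close> counts two losses: dropping that mass, and renormalising what is
  left.\<close>

lemma normal_density_uminus: "normal_density 0 s (- x) = normal_density 0 s x"
  by (simp add: normal_density_def)

lemma normal_density_zero_DERIV:
  assumes "s > 0"
  shows "(normal_density 0 s has_real_derivative - x / s\<^sup>2 * normal_density 0 s x) (at x)"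
  unfolding normal_density_def
  using assms by (auto intro!: derivative_eq_intros simp: field_simps power2_eq_square)

lemma continuous_normal_density_zero: "s > 0 \<Longrightarrow> continuous_on S (normal_density 0 s)"
  by (intro continuous_at_imp_continuous_on ballI DERIV_isCont[OF normal_density_zero_DERIV])

lemma normal_density_zero_tendsto:
  assumes "s > 0"
  shows "(normal_density 0 s \<longlongrightarrow> 0) at_top"
proof -
  have "LIM x at_top. 1 / (2 * s\<^sup>2) * x\<^sup>2 :> at_top"
    using assms by (intro filterlim_tendsto_pos_mult_at_top[OF tendsto_const] filterlim_pow_at_top filterlim_ident) auto
  then have "((\<lambda>x. exp (- (1 / (2 * s\<^sup>2) * x\<^sup>2))) \<longlongrightarrow> 0) at_top"
    by (intro filterlim_compose[OF exp_at_bot] filterlim_compose[OF filterlim_uminus_at_bot_at_top])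
  from tendsto_mult[OF tendsto_const this, of "1 / sqrt (2 * pi * s\<^sup>2)"]
  show ?thesis by (simp add: normal_density_def[abs_def] mult_ac)
qed

lemma integrable_normal_density_indicator:
  assumes "s > 0" "S \<in> sets borel"
  shows "integrable lborel (\<lambda>t. indicator S t * normal_density 0 s t)"
  using integrable_real_mult_indicator[OF _ integrable_normal_density[OF assms(1)], of S 0] assms(2)
  by (simp add: mult.commute)

text \<open>Reflection exchanges the two closed half lines, which share only the null set
  \<open>{0}\<close>, so each carries half of the total mass 1.\<close>

lemma normal_half_mass:
  assumes "s > 0"
  shows "(\<integral>t. indicator {0..} t * normal_density 0 s t \<partial>lborel) = 1 / 2"
proof -
  let ?p = "normal_density 0 s"
  have e: "(\<integral>t. indicator {0..} t * ?p t \<partial>lborel) = (\<integral>t. indicator {..0} t * ?p t \<partial>lborel)"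
    by (subst lborel_integral_real_affine[where c="-1" and t=0])
       (auto intro!: Bochner_Integration.integral_cong simp: normal_density_uminus indicator_def)
  have "(\<integral>t. indicator {0..} t * ?p t \<partial>lborel) + (\<integral>t. indicator {..0} t * ?p t \<partial>lborel)
     = (\<integral>t. indicator {0..} t * ?p t + indicator {..0} t * ?p t \<partial>lborel)"
    using assms by (intro Bochner_Integration.integral_add[symmetric] integrable_normal_density_indicator) auto
  also have "\<dots> = (\<integral>t. ?p t \<partial>lborel)"
    using AE_lborel_singleton[of "0::real"]
    by (intro integral_cong_AE) (auto simp: indicator_def)
  finally show ?thesis using e assms by simp
qed

text \<open>After the shift by \<open>z\<close> the cross term \<open>2 z t\<close> of the square is
  nonnegative, so the density at \<open>z + t\<close> is at most
  \<open>sqrt (2 * pi) * s * p(z) * p(t)\<close>, the prefactor cancelling one normalising constant.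
  Integrating over \<open>t \<ge> 0\<close> contributes the factor 1/2. The bound is sharp at
  \<open>z = 0\<close>.\<close>

lemma normal_tail_le_density:
  assumes "s > 0" "z \<ge> 0"
  shows "(\<integral>t. indicator {z..} t * normal_density 0 s t \<partial>lborel)
    \<le> sqrt (2 * pi) * s / 2 * normal_density 0 s z"
proof -
  let ?p = "normal_density 0 s"
  have p: "?p (z + t) \<le> sqrt (2 * pi) * s * ?p z * ?p t" if "t \<ge> 0" for t
  proof -
    have "(z + t)\<^sup>2 \<ge> z\<^sup>2 + t\<^sup>2" using assms that by (simp add: power2_eq_square algebra_simps)
    then have "- (z + t)\<^sup>2 / (2 * s\<^sup>2) \<le> - z\<^sup>2 / (2 * s\<^sup>2) + - t\<^sup>2 / (2 * s\<^sup>2)"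
      using assms by (simp add: divide_simps)
    then have "exp (- (z + t)\<^sup>2 / (2 * s\<^sup>2)) \<le> exp (- z\<^sup>2 / (2 * s\<^sup>2)) * exp (- t\<^sup>2 / (2 * s\<^sup>2))"
      by (simp add: exp_add[symmetric])
    then show ?thesis using assms
      by (simp add: normal_density_def real_sqrt_mult field_simps)
  qed
  have "(\<integral>t. indicator {z..} t * ?p t \<partial>lborel) = (\<integral>t. indicator {0..} t * ?p (z + t) \<partial>lborel)"
    by (subst lborel_integral_real_affine[where c="1" and t=z])
       (auto intro!: Bochner_Integration.integral_cong simp: indicator_def)
  also have "\<dots> \<le> (\<integral>t. (sqrt (2 * pi) * s * ?p z) * (indicator {0..} t * ?p t) \<partial>lborel)"
  proof (rule integral_mono)
    have "integrable lborel (\<lambda>t. indicator {z..} (z + 1 * t) * ?p (z + 1 * t))"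
      using assms by (intro lborel_integrable_real_affine integrable_normal_density_indicator) auto
    then show "integrable lborel (\<lambda>t. indicator {0..} t * ?p (z + t))"
      by (rule Bochner_Integration.integrable_cong[THEN iffD1, rotated -1]) (auto simp: indicator_def)
    show "integrable lborel (\<lambda>t. (sqrt (2 * pi) * s * ?p z) * (indicator {0..} t * ?p t))"
      using assms by (intro integrable_mult_right integrable_normal_density_indicator) auto
    show "indicator {0..} t * ?p (z + t) \<le> (sqrt (2 * pi) * s * ?p z) * (indicator {0..} t * ?p t)" for t
      using p[of t] by (auto simp: indicator_def)
  qed
  also have "\<dots> = sqrt (2 * pi) * s * ?p z * (1 / 2)"
    by (subst integral_mult_right_zero) (simp only: normal_half_mass[OF assms(1)])
  finally show ?thesis by simp
qed

text \<open>The Mills ratio bound: on the tail \<open>z\<close> is dominated by the variable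
  \<open>t\<close>, and \<open>t p(t)\<close> has the antiderivative
  \<open>- s\<^sup>2 p(t)\<close>, which vanishes at infinity.\<close>

lemma normal_tail_mult_le_density:
  assumes "s > 0" "z \<ge> 0"
  shows "z * (\<integral>t. indicator {z..} t * normal_density 0 s t \<partial>lborel) \<le> s\<^sup>2 * normal_density 0 s z"
proof -
  let ?p = "normal_density 0 s"
  have ft: "(\<integral>\<^sup>+t. ennreal (t * ?p t) * indicator {z..} t \<partial>lborel) = ennreal (0 - (- s\<^sup>2 * ?p z))"
  proof (rule nn_integral_FTC_atLeast)
    show "((\<lambda>t. - s\<^sup>2 * ?p t) \<longlongrightarrow> 0) at_top"
      using tendsto_mult[OF tendsto_const normal_density_zero_tendsto[OF assms(1)], of "- s\<^sup>2"] by simp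
    show "DERIV (\<lambda>t. - s\<^sup>2 * ?p t) t :> t * ?p t" if "z \<le> t" for t
      using DERIV_cmult[OF normal_density_zero_DERIV[OF assms(1), of t], of "- s\<^sup>2"] assms by simp
  qed (use assms in auto)
  have "ennreal (\<integral>t. z * (indicator {z..} t * ?p t) \<partial>lborel) = (\<integral>\<^sup>+t. ennreal (z * (indicator {z..} t * ?p t)) \<partial>lborel)"
    using assms by (intro nn_integral_eq_integral[symmetric] integrable_mult_right integrable_normal_density_indicator) auto
  also have "\<dots> \<le> (\<integral>\<^sup>+t. ennreal (t * ?p t) * indicator {z..} t \<partial>lborel)"
    by (intro nn_integral_mono) (auto simp: indicator_def intro!: ennreal_leI mult_right_mono)
  finally have "ennreal (\<integral>t. z * (indicator {z..} t * ?p t) \<partial>lborel) \<le> ennreal (s\<^sup>2 * ?p z)"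
    using ft by simp
  then show ?thesis by (simp add: ennreal_le_iff)
qed

lemma stein_equation_solution:
  fixes h :: "real \<Rightarrow> real"
  assumes s: "s > 0" and hb: "\<And>x. \<bar>h x\<bar> \<le> 1" and hc: "continuous_on UNIV h"
  obtains f f' where
    "\<And>x. (f has_real_derivative f' x) (at x)" "continuous_on UNIV f'"
    "\<And>x. \<bar>f x\<bar> \<le> sqrt (2 * pi) / s" "\<And>x. \<bar>f' x\<bar> \<le> 4 / s\<^sup>2"
    "\<And>x. s\<^sup>2 * f' x - x * f x = h x - (\<integral>y. h y \<partial>density lborel (\<lambda>z. ennreal (normal_density 0 s z)))"
proof -
  let ?p = "normal_density 0 s"
  define m where "m = (\<integral>y. h y \<partial>density lborel (\<lambda>z. ennreal (?p z)))"
  define k where "k = (\<lambda>x. h x - m)"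
  have hm[measurable]: "h \<in> borel_measurable borel" using hc by (rule borel_measurable_continuous_onI)
  have meq: "m = (\<integral>y. ?p y * h y \<partial>lborel)"
    unfolding m_def by (subst integral_density) auto
  have phb: "\<bar>?p y * h y\<bar> \<le> ?p y" for y
    using mult_left_mono[OF hb[of y], of "?p y"] by (simp add: abs_mult)
  have ihp: "integrable lborel (\<lambda>y. ?p y * h y)"
    by (rule Bochner_Integration.integrable_bound[OF integrable_normal_density[OF s, of 0]]) (use phb in auto)
  have "\<bar>m\<bar> \<le> (\<integral>y. ?p y \<partial>lborel)"
    unfolding meq using phb by (intro integral_abs_bound_integral ihp integrable_normal_density s) auto
  then have m1: "\<bar>m\<bar> \<le> 1" using s by simp
  have kb: "\<bar>k x\<bar> \<le> 2" for x using hb[of x] m1 unfolding k_def by linarith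
  have kc: "continuous_on S k" for S
    unfolding k_def by (intro continuous_intros continuous_on_subset[OF hc]) auto
  have km[measurable]: "k \<in> borel_measurable borel" unfolding k_def by measurable
  have kp: "\<bar>k t * ?p t\<bar> \<le> 2 * ?p t" for t
    using mult_right_mono[OF kb[of t], of "?p t"] by (simp add: abs_mult)
  have ikp: "integrable lborel (\<lambda>t. indicator S t * (k t * ?p t))" if [measurable]: "S \<in> sets borel" for S
    by (rule Bochner_Integration.integrable_bound[OF integrable_mult_right[OF integrable_normal_density[OF s, of 0], of 2]])
       (use kp in \<open>auto simp: indicator_def\<close>)
  have ikp0: "integrable lborel (\<lambda>t. k t * ?p t)" using ikp[of UNIV] by simp
  have total: "(\<integral>t. k t * ?p t \<partial>lborel) = 0"
  proof -
    have "(\<integral>t. k t * ?p t \<partial>lborel) = (\<integral>t. ?p t * h t - m * ?p t \<partial>lborel)"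
      unfolding k_def by (simp add: algebra_simps)
    also have "\<dots> = m - m * 1"
      using ihp s by (subst Bochner_Integration.integral_diff) (auto simp: meq)
    finally show ?thesis by simp
  qed
  \<comment> \<open>This is \<open>s\<^sup>2 p f\<close>, obtained with \<open>p\<close> as
    integrating factor. Starting at minus infinity, together with total integral zero, singles out
    the bounded solution: any other differs from it by a multiple of \<open>1 / p\<close>.\<close>
  define I where "I = (\<lambda>x. \<integral>t. indicator {..x} t * (k t * ?p t) \<partial>lborel)"
  \<comment> \<open>As \<open>k p\<close> has integral zero, \<open>I\<close> can be read from
    either end. Hence the tail on the side of \<open>x\<close> is always available, and up to
    reflection it is the tail beyond \<open>|x|\<close>.\<close>
  have Ipos: "I x = - (\<integral>t. indicator {x..} t * (k t * ?p t) \<partial>lborel)" for x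
  proof -
    have "I x + (\<integral>t. indicator {x..} t * (k t * ?p t) \<partial>lborel)
      = (\<integral>t. indicator {..x} t * (k t * ?p t) + indicator {x..} t * (k t * ?p t) \<partial>lborel)"
      unfolding I_def by (intro Bochner_Integration.integral_add[symmetric] ikp) auto
    also have "\<dots> = (\<integral>t. k t * ?p t \<partial>lborel)"
      using AE_lborel_singleton[of "x::real"]
      by (intro integral_cong_AE) (auto simp: indicator_def)
    finally show ?thesis using total by simp
  qed
  \<comment> \<open>The fundamental theorem is applied on a compact interval: the integral is cut at
    \<open>x - 1\<close>, so that only the upper piece depends on the endpoint. The two pieces
    overlap in a single point.\<close>
  have Ider: "(I has_real_derivative k x * ?p x) (at x)" for x
  proof -
    let ?a = "x - 1" and ?b = "x + 1"
    let ?g = "\<lambda>t. k t * ?p t"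
    have gc: "continuous_on {?a..?b} ?g" by (intro continuous_intros kc continuous_normal_density_zero s)
    have "((\<lambda>y. integral {?a..y} ?g) has_real_derivative ?g x) (at x within {?a..?b})"
      by (rule integral_has_real_derivative[OF gc]) auto
    then have "((\<lambda>y. I ?a + integral {?a..y} ?g) has_real_derivative ?g x) (at x within {?a..?b})"
      by (auto intro!: derivative_eq_intros)
    then have d: "((\<lambda>y. I ?a + integral {?a..y} ?g) has_real_derivative ?g x) (at x)"
      by (subst (asm) at_within_interior) auto
    have Ieq: "I ?a + integral {?a..y} ?g = I y" if "y \<in> {?a<..<?b}" for y
    proof -
      have "integral {?a..y} ?g = (\<integral>t. indicator {?a..y} t * ?g t \<partial>lborel)"
        using set_borel_integral_eq_integral(2)[of "{?a..y}" ?g] ikp[of "{?a..y}"]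
        by (simp add: set_integrable_def set_lebesgue_integral_def)
      then have "I ?a + integral {?a..y} ?g =
          (\<integral>t. indicator {..?a} t * ?g t + indicator {?a..y} t * ?g t \<partial>lborel)"
        unfolding I_def using ikp by (simp add: Bochner_Integration.integral_add)
      also have "\<dots> = I y"
        unfolding I_def using AE_lborel_singleton[of "?a"] that
        by (intro integral_cong_AE) (auto simp: indicator_def)
      finally show ?thesis .
    qed
    show ?thesis
      by (rule has_field_derivative_transform_within_open[OF d, of "{?a<..<?b}"]) (auto simp: Ieq)
  qed
  have I_tail: "\<bar>I x\<bar> \<le> 2 * (\<integral>t. indicator {\<bar>x\<bar>..} t * ?p t \<partial>lborel)" for x
  proof -
    have *: "\<bar>\<integral>t. indicator S t * (k t * ?p t) \<partial>lborel\<bar> \<le> 2 * (\<integral>t. indicator S t * ?p t \<partial>lborel)"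
      if [measurable]: "S \<in> sets borel" for S
    proof -
      have "\<bar>\<integral>t. indicator S t * (k t * ?p t) \<partial>lborel\<bar> \<le> (\<integral>t. 2 * (indicator S t * ?p t) \<partial>lborel)"
      proof (rule integral_abs_bound_integral)
        show "integrable lborel (\<lambda>t. 2 * (indicator S t * ?p t))"
          using s that by (intro integrable_mult_right integrable_normal_density_indicator)
        show "\<bar>indicator S t * (k t * ?p t)\<bar> \<le> 2 * (indicator S t * ?p t)" for t
          using kp[of t] by (auto simp: indicator_def)
      qed (use ikp that in auto)
      then show ?thesis by simp
    qed
    show ?thesis
    proof (cases "x \<ge> 0")
      case True then show ?thesis using *[of "{x..}"] by (simp add: Ipos)
    next
      case False
      have "(\<integral>t. indicator {..x} t * ?p t \<partial>lborel) = (\<integral>t. indicator {-x..} t * ?p t \<partial>lborel)"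
        by (subst lborel_integral_real_affine[where c="-1" and t=0])
           (auto intro!: Bochner_Integration.integral_cong simp: normal_density_uminus indicator_def)
      then show ?thesis using *[of "{..x}"] False by (simp add: I_def)
    qed
  qed
  define f where "f = (\<lambda>x. I x / (s\<^sup>2 * ?p x))"
  \<comment> \<open>The equation is solved for the derivative. Stein's equation then holds by
    construction and \<open>f'\<close> inherits continuity from \<open>k\<close> and
    \<open>f\<close>; what has to be shown is that it is the derivative of \<open>f\<close>.\<close>
  define f' where "f' = (\<lambda>x. (k x + x * f x) / s\<^sup>2)"
  have pp: "?p x > 0" for x using s by (rule normal_density_pos)
  have pabs: "?p \<bar>x\<bar> = ?p x" for x by (simp add: normal_density_def)
  have sp: "s\<^sup>2 * ?p x > 0" for x using pp s by simp
  have fder: "(f has_real_derivative f' x) (at x)" for x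
  proof -
    have "(f has_real_derivative
      (k x * ?p x * (s\<^sup>2 * ?p x) - I x * (s\<^sup>2 * (- x / s\<^sup>2 * ?p x))) / ((s\<^sup>2 * ?p x) * (s\<^sup>2 * ?p x))) (at x)"
      unfolding f_def
      by (rule DERIV_divide[OF Ider DERIV_cmult[OF normal_density_zero_DERIV[OF s]]]) (use s pp[of x] in simp)
    also have "(k x * ?p x * (s\<^sup>2 * ?p x) - I x * (s\<^sup>2 * (- x / s\<^sup>2 * ?p x))) / ((s\<^sup>2 * ?p x) * (s\<^sup>2 * ?p x)) = f' x"
    proof -
      have "(k' * q * (u * q) - i * (u * (- x / u * q))) / ((u * q) * (u * q)) = (k' + x * (i / (u * q))) / u"
        if "q > 0" "u > 0" for k' q i u :: real
        using that by (simp add: divide_simps) (simp add: algebra_simps)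
      then show ?thesis using s pp[of x] unfolding f'_def f_def by simp
    qed
    finally show ?thesis .
  qed
  have xf: "\<bar>x * f x\<bar> \<le> 2" for x
  proof -
    have "\<bar>x\<bar> * \<bar>I x\<bar> \<le> \<bar>x\<bar> * (2 * (\<integral>t. indicator {\<bar>x\<bar>..} t * ?p t \<partial>lborel))"
      by (intro mult_left_mono I_tail) auto
    also have "\<dots> \<le> 2 * (s\<^sup>2 * ?p x)"
      using normal_tail_mult_le_density[OF s, of "\<bar>x\<bar>"] by (simp add: pabs)
    finally have "\<bar>x\<bar> * \<bar>I x\<bar> / (s\<^sup>2 * ?p x) \<le> 2" by (subst pos_divide_le_eq[OF sp])
    then show ?thesis using s pp[of x] by (simp add: f_def abs_mult)
  qed
  have fb: "\<bar>f x\<bar> \<le> sqrt (2 * pi) / s" for x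
  proof -
    have "\<bar>I x\<bar> \<le> sqrt (2 * pi) * s * ?p x"
      using I_tail[of x] normal_tail_le_density[OF s, of "\<bar>x\<bar>"] by (simp add: pabs)
    then have "\<bar>I x\<bar> / (s\<^sup>2 * ?p x) \<le> sqrt (2 * pi) * s * ?p x / (s\<^sup>2 * ?p x)"
      using sp[of x] by (intro divide_right_mono) auto
    moreover have "\<bar>f x\<bar> = \<bar>I x\<bar> / (s\<^sup>2 * ?p x)" using s pp[of x] by (simp add: f_def abs_mult)
    ultimately have "\<bar>f x\<bar> \<le> sqrt (2 * pi) * s * ?p x / (s\<^sup>2 * ?p x)" by simp
    also have "\<dots> = sqrt (2 * pi) / s" using s pp[of x] by (simp add: power2_eq_square)
    finally show ?thesis .
  qed
  have fc: "continuous_on UNIV f" by (intro continuous_at_imp_continuous_on ballI DERIV_isCont[OF fder])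
  show ?thesis
  proof (rule that[of f f'])
    show "continuous_on UNIV f'" unfolding f'_def using s by (intro continuous_intros fc kc) auto
    show "\<bar>f' x\<bar> \<le> 4 / s\<^sup>2" for x
    proof -
      have "\<bar>k x + x * f x\<bar> / s\<^sup>2 \<le> 4 / s\<^sup>2"
        using kb[of x] xf[of x] by (intro divide_right_mono) auto
      then show ?thesis by (simp add: f'_def)
    qed
    show "s\<^sup>2 * f' x - x * f x = h x - (\<integral>y. h y \<partial>density lborel (\<lambda>z. ennreal (?p z)))" for x
      using s by (simp add: f'_def k_def m_def)
  qed (use fder fb in auto)
qed

section \<open>Calculus of \<open>C\<^sup>1\<close> functions on a normed space\<close>

text \<open>Order one of \<open>Ck_on\<close> as a constant of its own, handled through the
  introduction and destruction rules below. Continuity of the derivative is asked separately for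
  each fixed direction.\<close>

definition C1_on :: "'e::real_normed_vector set \<Rightarrow> ('e \<Rightarrow> 'f::real_normed_vector) \<Rightarrow> bool"
  where "C1_on S f \<longleftrightarrow> Ck_on 1 S f"

lemma C1_on_iff:
  "C1_on S f \<longleftrightarrow> (\<forall>x\<in>S. f differentiable at x) \<and>
     (\<forall>v. continuous_on S (\<lambda>x. frechet_derivative f (at x) v))"
  by (simp add: C1_on_def)

lemma C1_onI:
  assumes "\<And>x. x \<in> S \<Longrightarrow> (f has_derivative f' x) (at x)"
    and "\<And>v. continuous_on S (\<lambda>x. f' x v)"
  shows "C1_on S f"
  unfolding C1_on_iff
proof (intro conjI ballI allI)
  show "f differentiable at x" if "x \<in> S" for x
    using assms(1)[OF that] by (rule differentiableI)
  show "continuous_on S (\<lambda>x. frechet_derivative f (at x) v)" for v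
    using assms(2)[of v] by (rule continuous_on_eq) (simp add: frechet_derivative_at[OF assms(1), symmetric])
qed

lemma C1_onD:
  assumes "C1_on S f"
  shows "x \<in> S \<Longrightarrow> (f has_derivative frechet_derivative f (at x)) (at x)"
    and "continuous_on S (\<lambda>x. frechet_derivative f (at x) v)"
  using assms by (auto simp: C1_on_iff frechet_derivative_works)

lemma C1_on_imp_continuous_on: "C1_on S f \<Longrightarrow> continuous_on S f"
  by (meson C1_onD(1) continuous_at_imp_continuous_on has_derivative_continuous)

lemma C1_on_subset: "C1_on S f \<Longrightarrow> T \<subseteq> S \<Longrightarrow> C1_on T f"
  unfolding C1_on_iff by (meson continuous_on_subset subsetD)

lemma C1_on_const: "C1_on S (\<lambda>x. c)"
  by (rule C1_onI[where f'="\<lambda>_ _. 0"]) auto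

lemma C1_on_cong:
  assumes "open S" "\<And>x. x \<in> S \<Longrightarrow> f x = g x" "C1_on S g"
  shows "C1_on S f"
proof (rule C1_onI)
  show "(f has_derivative frechet_derivative g (at x)) (at x)" if "x \<in> S" for x
    by (rule has_derivative_transform_within_open[OF C1_onD(1)[OF assms(3) that] assms(1) that])
      (simp add: assms(2))
qed (rule C1_onD(2)[OF assms(3)])

text \<open>The gluing principle: a function given by a formula near its support and by zero
  elsewhere is treated separately on two open sets that cover the space.\<close>

lemma C1_on_local:
  assumes "\<And>x. x \<in> S \<Longrightarrow> \<exists>U. open U \<and> x \<in> U \<and> C1_on (S \<inter> U) f"
  shows "C1_on S f"
  unfolding C1_on_iff
proof (intro conjI ballI allI)
  show "f differentiable at x" if "x \<in> S" for x
    using assms[OF that] that unfolding C1_on_iff by blast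
  show "continuous_on S (\<lambda>x. frechet_derivative f (at x) v)" for v
    unfolding continuous_on_eq_continuous_within
  proof
    fix x assume x: "x \<in> S"
    then obtain U where U: "open U" "x \<in> U" "C1_on (S \<inter> U) f" using assms by blast
    then have "continuous (at x within S \<inter> U) (\<lambda>x. frechet_derivative f (at x) v)"
      using x C1_onD(2)[OF U(3), of v] by (simp add: continuous_on_eq_continuous_within)
    moreover have "at x within S \<inter> U = at x within S"
      by (rule at_within_nhd[OF U(2,1)]) auto
    ultimately show "continuous (at x within S) (\<lambda>x. frechet_derivative f (at x) v)" by simp
  qed
qed

lemma C1_on_add:
  assumes "C1_on S f" "C1_on S g" shows "C1_on S (\<lambda>x. f x + g x)"
  by (rule C1_onI[OF has_derivative_add[OF C1_onD(1)[OF assms(1)] C1_onD(1)[OF assms(2)]]])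
    (auto intro!: continuous_intros C1_onD(2) assms)

lemma C1_on_bounded_bilinear:
  assumes "bounded_bilinear p" "C1_on S f" "C1_on S g"
  shows "C1_on S (\<lambda>x. p (f x) (g x))"
  by (rule C1_onI[OF bounded_bilinear.FDERIV[OF assms(1) C1_onD(1)[OF assms(2)] C1_onD(1)[OF assms(3)]]])
    (auto intro!: continuous_on_add C1_onD(2) assms bounded_bilinear.continuous_on[OF assms(1)]
      C1_on_imp_continuous_on[OF assms(2)] C1_on_imp_continuous_on[OF assms(3)])

lemma C1_on_mult:
  fixes f g :: "'e::real_normed_vector \<Rightarrow> real"
  shows "C1_on S f \<Longrightarrow> C1_on S g \<Longrightarrow> C1_on S (\<lambda>x. f x * g x)"
  by (rule C1_on_bounded_bilinear[OF bounded_bilinear_mult])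

lemma C1_on_bounded_linear:
  assumes "bounded_linear p" "C1_on S f"
  shows "C1_on S (\<lambda>x. p (f x))"
  by (rule C1_onI[OF bounded_linear.has_derivative[OF assms(1) C1_onD(1)[OF assms(2)]]])
    (auto intro!: bounded_linear.continuous_on[OF assms(1)] C1_onD(2) assms)

lemma C1_on_sum:
  "(\<And>i. i \<in> I \<Longrightarrow> C1_on S (f i)) \<Longrightarrow> C1_on S (\<lambda>x. \<Sum>i\<in>I. f i x)"
  by (induction I rule: infinite_finite_induct) (auto intro: C1_on_const C1_on_add)

lemma C1_on_prod:
  fixes f :: "'i \<Rightarrow> 'e::real_normed_vector \<Rightarrow> real"
  shows "(\<And>i. i \<in> I \<Longrightarrow> C1_on S (f i)) \<Longrightarrow> C1_on S (\<lambda>x. \<Prod>i\<in>I. f i x)"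
  by (induction I rule: infinite_finite_induct) (auto intro: C1_on_const C1_on_mult)

lemma C1_on_det:
  fixes M :: "'e::real_normed_vector \<Rightarrow> real ^ 'n ^ 'n"
  assumes "\<And>i j. C1_on S (\<lambda>x. M x $ i $ j)"
  shows "C1_on S (\<lambda>x. det (M x))"
  unfolding det_def by (intro C1_on_sum C1_on_mult C1_on_const C1_on_prod assms)

text \<open>The set \<open>T\<close> allows outer functions that are differentiable on part of the
  line only, such as \<open>sqrt\<close>, \<open>inverse\<close> and \<open>ln\<close> on the
  positive numbers.\<close>

lemma C1_on_compose_real:
  fixes f :: "'e::real_normed_vector \<Rightarrow> real" and q :: "real \<Rightarrow> real"
  assumes f: "C1_on S f"
    and q: "\<And>t. t \<in> T \<Longrightarrow> (q has_real_derivative q' t) (at t)" "continuous_on T q'"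
    and T: "\<And>x. x \<in> S \<Longrightarrow> f x \<in> T"
  shows "C1_on S (\<lambda>x. q (f x))"
proof (rule C1_onI)
  show "((\<lambda>x. q (f x)) has_derivative (\<lambda>v. q' (f x) * frechet_derivative f (at x) v)) (at x)"
    if "x \<in> S" for x
    using has_derivative_compose[OF C1_onD(1)[OF f that] q(1)[OF T[OF that], unfolded has_field_derivative_def]] .
  show "continuous_on S (\<lambda>x. q' (f x) * frechet_derivative f (at x) v)" for v
    using T by (intro continuous_intros C1_onD(2)[OF f] continuous_on_compose2[OF q(2)]
        C1_on_imp_continuous_on[OF f]) auto
qed

section \<open>Integrals of compactly supported derivatives on Euclidean space\<close>

lemma continuous_compact_support_integrable:
  fixes f :: "'e::euclidean_space \<Rightarrow> real"
  assumes "continuous_on UNIV f" "compact K" "\<And>x. x \<notin> K \<Longrightarrow> f x = 0"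
  shows "integrable lborel f"
proof -
  have "integrable lborel (\<lambda>x. indicator K x *\<^sub>R f x)"
    by (intro borel_integrable_compact assms(2) continuous_on_subset[OF assms(1)]) auto
  moreover have "(\<lambda>x. indicator K x *\<^sub>R f x) = f" using assms(3) by (auto simp: indicator_def fun_eq_iff)
  ultimately show ?thesis by simp
qed

lemma frechet_derivative_eq_0_outside:
  assumes "closed K" "\<And>x. x \<notin> K \<Longrightarrow> f x = 0" "x \<notin> K"
  shows "frechet_derivative f (at x) = (\<lambda>_. 0)"
proof -
  have "(f has_derivative (\<lambda>_. 0)) (at x)"
    by (rule has_derivative_transform_within_open[OF has_derivative_const[of 0], of "- K"])
      (use assms in auto)
  then show ?thesis by (rule frechet_derivative_at[symmetric])
qed

text \<open>By translation invariance of \<open>lborel\<close>, all difference quotients of \<open>F\<close> have integral zero;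
  let the step tend to zero.\<close>

lemma integral_derivative_compact_support:
  fixes F :: "'e::euclidean_space \<Rightarrow> real"
  assumes F: "C1_on UNIV F" and K: "compact K" "\<And>x. x \<notin> K \<Longrightarrow> F x = 0"
  shows "(\<integral>x. frechet_derivative F (at x) e \<partial>lborel) = 0"
proof -
  define D where "D = (\<lambda>x. frechet_derivative F (at x) e)"
  have Dc: "continuous_on UNIV D" unfolding D_def by (rule C1_onD(2)[OF F])
  have D0: "D x = 0" if "x \<notin> K" for x
    using frechet_derivative_eq_0_outside[OF compact_imp_closed[OF K(1)] K(2) that] by (simp add: D_def)
  have "bounded (D ` K)"
    by (intro compact_imp_bounded compact_continuous_image K continuous_on_subset[OF Dc]) auto
  then obtain M0 where "\<And>x. x \<in> K \<Longrightarrow> \<bar>D x\<bar> \<le> M0" unfolding bounded_iff by auto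
  then have M: "\<bar>D x\<bar> \<le> \<bar>M0\<bar>" for x
    using D0[of x] by (cases "x \<in> K") force+
  have Fi: "integrable lborel F"
    by (rule continuous_compact_support_integrable[OF C1_on_imp_continuous_on[OF F] K])
  have Fm[measurable]: "F \<in> borel_measurable borel"
    by (rule borel_measurable_continuous_onI[OF C1_on_imp_continuous_on[OF F]])
  have Dm[measurable]: "D \<in> borel_measurable borel" by (rule borel_measurable_continuous_onI[OF Dc])
  have line: "((\<lambda>t. F (x + t *\<^sub>R e)) has_real_derivative D (x + t *\<^sub>R e)) (at t)" for x t
  proof -
    let ?F' = "frechet_derivative F (at (x + t *\<^sub>R e))"
    have F': "(F has_derivative ?F') (at (x + t *\<^sub>R e))" by (rule C1_onD(1)[OF F]) auto
    have "((\<lambda>t. x + t *\<^sub>R e) has_derivative (\<lambda>h. h *\<^sub>R e)) (at t)"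
      by (auto intro!: derivative_eq_intros)
    from has_derivative_compose[OF this F']
    have "((\<lambda>t. F (x + t *\<^sub>R e)) has_derivative (\<lambda>h. ?F' (h *\<^sub>R e))) (at t)" .
    moreover have "(\<lambda>h. ?F' (h *\<^sub>R e)) = (*) (D (x + t *\<^sub>R e))"
      using linear_scale[OF has_derivative_linear[OF F'], of _ e] by (simp add: fun_eq_iff D_def)
    ultimately show ?thesis by (simp only: has_field_derivative_def)
  qed
  define s where "s = (\<lambda>n x. (F (x + inverse (real (Suc n)) *\<^sub>R e) - F x) / inverse (real (Suc n)))"
  obtain R where R: "K \<subseteq> cball 0 R"
    using compact_imp_bounded[OF K(1)] unfolding bounded_iff by (auto simp: subset_iff)
  \<comment> \<open>Domination: by the mean value theorem a difference quotient is a value of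
    \<open>D\<close>, hence at most \<open>\<bar>M0\<bar>\<close>. The steps have length at most
    \<open>norm e\<close>, so outside the ball enlarged by \<open>norm e\<close> both endpoints
    avoid \<open>K\<close> and the quotient is zero.\<close>
  define B where "B = cball (0::'e) (R + norm e)"
  have sb: "norm (s n x) \<le> \<bar>M0\<bar> * indicator B x" for n x
  proof (cases "x \<in> B")
    case True
    let ?t = "inverse (real (Suc n))"
    have "\<exists>z>0. z < ?t \<and> F (x + ?t *\<^sub>R e) - F (x + 0 *\<^sub>R e) = (?t - 0) * D (x + z *\<^sub>R e)"
      by (rule MVT2[OF _ line]) simp
    then obtain z where "F (x + ?t *\<^sub>R e) - F x = ?t * D (x + z *\<^sub>R e)" by auto
    then have "s n x = D (x + z *\<^sub>R e)" by (simp add: s_def)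
    then show ?thesis using M True by simp
  next
    case False
    have 1: "norm (inverse (real (Suc n)) *\<^sub>R e) \<le> norm e"
      by (simp add: mult_left_le_one_le inverse_le_1_iff)
    have 2: "norm x \<le> norm (x + inverse (real (Suc n)) *\<^sub>R e) + norm (inverse (real (Suc n)) *\<^sub>R e)"
      by (metis add_diff_cancel_right' norm_triangle_ineq4)
    have 3: "norm x > R + norm e" using False by (simp add: B_def)
    have "\<not> norm x \<le> R" "\<not> norm (x + inverse (real (Suc n)) *\<^sub>R e) \<le> R"
      using 1 2 3 norm_ge_zero[of e] by linarith+
    then have "x \<notin> K" "x + inverse (real (Suc n)) *\<^sub>R e \<notin> K"
      using R by (auto simp: subset_iff simp del: inverse_Suc)
    then show ?thesis using K(2) by (simp add: s_def)
  qed
  have "(\<lambda>n. \<integral>x. s n x \<partial>lborel) \<longlonglongrightarrow> (\<integral>x. D x \<partial>lborel)"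
  proof (rule integral_dominated_convergence[where w="\<lambda>x. \<bar>M0\<bar> * indicator B x"])
    show "integrable lborel (\<lambda>x. \<bar>M0\<bar> * indicator B x)"
      using emeasure_bounded_finite[OF bounded_cball, of "0::'e" "R + norm e"]
      by (intro integrable_mult_right integrable_real_indicator) (auto simp: B_def)
    show "AE x in lborel. (\<lambda>n. s n x) \<longlonglongrightarrow> D x"
    proof (rule AE_I2)
      fix x
      have "((\<lambda>t. (F (x + t *\<^sub>R e) - F x) / t) \<longlongrightarrow> D x) (at 0)"
        using line[of x 0] by (simp add: has_field_derivative_iff)
      moreover have "filterlim (\<lambda>n. inverse (real (Suc n))) (at 0) sequentially"
        using LIMSEQ_inverse_real_of_nat by (simp add: filterlim_at del: of_nat_Suc)
      ultimately show "(\<lambda>n. s n x) \<longlonglongrightarrow> D x"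
        unfolding s_def by (rule filterlim_compose)
    qed
  qed (use sb in \<open>auto simp: s_def\<close>)
  moreover have "(\<integral>x. s n x \<partial>lborel) = 0" for n
  proof -
    let ?a = "inverse (real (Suc n)) *\<^sub>R e"
    have d: "lborel = distr lborel borel (\<lambda>x. ?a + x)" using lborel_distr_plus[of ?a] by simp
    have "integrable (distr lborel borel (\<lambda>x. ?a + x)) F" using Fi d by simp
    then have i: "integrable lborel (\<lambda>x. F (x + ?a))"
      by (subst (asm) integrable_distr_eq) (auto simp: add.commute)
    have "(\<integral>x. F x \<partial>lborel) = (\<integral>x. F (x + ?a) \<partial>lborel)"
      by (subst d, subst integral_distr) (auto simp: add.commute)
    then show ?thesis using i Fi by (simp add: s_def)
  qed
  ultimately show ?thesis unfolding D_def by (simp add: LIMSEQ_const_iff)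
qed

text \<open>Positive definite matrices form a convex set containing the identity, on which the determinant
  does not vanish.\<close>

lemma det_pos_definite:
  fixes M :: "real ^ 'n ^ 'n"
  assumes pd: "\<And>v. v \<noteq> 0 \<Longrightarrow> v \<bullet> (M *v v) > 0"
  shows "det M > 0"
proof -
  define N where "N = (\<lambda>t::real. (1 - t) *\<^sub>R mat 1 + t *\<^sub>R M)"
  have nz: "det (N t) \<noteq> 0" if t: "0 \<le> t" "t \<le> 1" for t
  proof -
    have "v = 0" if "N t *v v = 0" for v
    proof (rule ccontr)
      assume "v \<noteq> 0"
      have "v \<bullet> (N t *v v) = (1 - t) * (v \<bullet> v) + t * (v \<bullet> (M *v v))"
        by (simp add: N_def matrix_vector_mult_add_rdistrib scaleR_matrix_vector_assoc[symmetric] inner_add_right)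
      moreover have "\<dots> > 0"
        using t pd[OF \<open>v \<noteq> 0\<close>] \<open>v \<noteq> 0\<close>
        by (cases "t = 0") (auto intro!: add_nonneg_pos)
      ultimately show False using that by simp
    qed
    then show ?thesis
      by (simp add: invertible_det_nz[symmetric] invertible_left_inverse matrix_left_invertible_ker)
  qed
  have cont: "continuous_on {0..1} (\<lambda>t. det (N t))"
    unfolding det_def N_def by (simp add: continuous_intros)
  show ?thesis
  proof (rule ccontr)
    assume "\<not> det M > 0"
    then have "det (N 1) \<le> 0" "det (N 0) \<ge> 0" by (auto simp: N_def)
    then obtain t where "0 \<le> t" "t \<le> 1" "det (N t) = 0"
      using IVT2'[of "\<lambda>t. det (N t)" 1 0 0] cont by auto
    then show False using nz by blast
  qed
qed

section \<open>\<open>C\<^sup>1\<close> functions and vector fields on a manifold\<close>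

text \<open>The squared positive part is C1 across zero; it serves as the radial profile of the bump
  functions.\<close>

lemma DERIV_max_0_power2:
  "((\<lambda>t::real. (max 0 t)\<^sup>2) has_real_derivative 2 * max 0 t) (at t)"
proof -
  consider "t < 0" | "t > 0" | "t = 0" by linarith
  then show ?thesis
  proof cases
    case 1
    have "((\<lambda>t::real. (max 0 t)\<^sup>2) has_real_derivative 0) (at t)"
      by (rule has_field_derivative_transform_within_open[of "\<lambda>_. 0" _ _ "{..<0}"]) (use 1 in auto)
    with 1 show ?thesis by simp
  next
    case 2
    have "((\<lambda>t::real. (max 0 t)\<^sup>2) has_real_derivative 2 * t) (at t)"
      by (rule has_field_derivative_transform_within_open[of "\<lambda>t. t\<^sup>2" _ _ "{0<..}"])
        (use 2 in \<open>auto intro!: derivative_eq_intros\<close>)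
    with 2 show ?thesis by simp
  next
    case 3
    have "((\<lambda>h::real. (max 0 h)\<^sup>2 / h) \<longlongrightarrow> 0) (at 0)"
    proof (rule Lim_null_comparison)
      show "\<forall>\<^sub>F h in at 0. norm ((max 0 h)\<^sup>2 / h) \<le> \<bar>h\<bar>"
        by (intro always_eventually) (auto simp: max_def power2_eq_square)
    qed (rule tendsto_rabs_zero[OF tendsto_ident_at])
    with 3 show ?thesis by (simp add: has_field_derivative_iff)
  qed
qed

text \<open>The geometry, separated from the statistics: the Fisher metric enters by interpretation
  in the final theorem. A single field is fixed because every derivative and divergence in the bound
  is taken along it.\<close>

locale riemannian_vector_field =
  fixes A :: "('a::{t2_space, second_countable_topology}, 'p::finite) chart set"
    and g :: "('a, 'p) metric_components" and vol :: "'a measure"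
    and V :: "('a, 'p) field_components"
  assumes atlas: "smooth_atlas A"
    and metric: "riemannian_metric A g"
    and volume: "riemannian_volume A g vol"
    and field: "C1_vector_field A V"
begin

abbreviation img :: "('a, 'p) chart \<Rightarrow> (real ^ 'p) set"
  where "img c \<equiv> snd c ` fst c"

lemma chart_facts:
  assumes "c \<in> A"
  shows open_domain: "open (fst c)" and open_img: "open (img c)"
    and continuous_chart: "continuous_on (fst c) (snd c)"
    and continuous_chart_inv: "continuous_on (img c) (chart_inv c)"
    and chart_inv_chart: "\<theta> \<in> fst c \<Longrightarrow> chart_inv c (snd c \<theta>) = \<theta>"
    and chart_chart_inv: "y \<in> img c \<Longrightarrow> snd c (chart_inv c y) = y"
    and chart_inv_in: "y \<in> img c \<Longrightarrow> chart_inv c y \<in> fst c"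
  using assms atlas unfolding smooth_atlas_def is_chart_def homeomorphism_def by blast+

lemma open_chart_image:
  assumes "c \<in> A" "open W"
  shows "open (snd c ` (fst c \<inter> W))"
proof -
  have "snd c ` (fst c \<inter> W) = img c \<inter> chart_inv c -` W"
    using chart_inv_chart[OF assms(1)] by (auto simp: image_iff)
  then show ?thesis
    using continuous_open_preimage[OF continuous_chart_inv open_img] assms by simp
qed

lemma chart_at_props: "chart_at A \<theta> \<in> A" "\<theta> \<in> fst (chart_at A \<theta>)"
proof -
  have "\<theta> \<in> (\<Union>c\<in>A. fst c)" using atlas by (simp add: smooth_atlas_def)
  then have "\<exists>c. c \<in> A \<and> \<theta> \<in> fst c" by blast
  from someI_ex[OF this] show "chart_at A \<theta> \<in> A" "\<theta> \<in> fst (chart_at A \<theta>)"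
    by (auto simp: chart_at_def)
qed

lemma continuous_on_chart_domain:
  assumes "c \<in> A" "W \<subseteq> fst c" "continuous_on (snd c ` W) (h \<circ> chart_inv c)"
  shows "continuous_on W h"
proof -
  have "continuous_on W ((h \<circ> chart_inv c) \<circ> snd c)"
    using continuous_on_subset[OF continuous_chart[OF assms(1)] assms(2)] assms(3) by (rule continuous_on_compose)
  then show ?thesis
    by (rule continuous_on_eq) (use assms(2) chart_inv_chart[OF assms(1)] in auto)
qed

lemma continuous_on_charts:
  assumes "\<And>c. c \<in> A \<Longrightarrow> continuous_on (fst c) h"
  shows "continuous_on UNIV h"
proof -
  have "continuous_on (\<Union>c\<in>A. fst c) h"
    using assms open_domain by (intro continuous_on_open_UN)
  then show ?thesis using atlas by (simp add: smooth_atlas_def)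
qed

lemma continuous_on_zero_extension:
  fixes h :: "'a \<Rightarrow> 'b::{topological_space,zero}"
  assumes "open U" "closed K" "K \<subseteq> U" "continuous_on U h" "\<And>x. x \<notin> K \<Longrightarrow> h x = 0"
  shows "continuous_on UNIV h"
proof -
  have "continuous_on (- K) h" by (rule continuous_on_eq[OF continuous_on_const]) (use assms in auto)
  then have "continuous_on (U \<union> - K) h"
    using assms by (intro continuous_on_open_Un) auto
  moreover have "U \<union> - K = UNIV" using assms by auto
  ultimately show ?thesis by simp
qed

lemma C1_transition:
  assumes "c \<in> A" "d \<in> A"
  shows "C1_on (snd c ` (fst c \<inter> fst d)) (transition c d)"
  using atlas assms unfolding smooth_atlas_def smooth_on_def C1_on_def by blast

text \<open>A version of \<open>C1_function\<close> relative to a subset, meant for open sets: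
  regularity is checked on the members of an open cover and glued with
  \<open>C1_in_Un\<close>.\<close>

definition C1_in :: "'a set \<Rightarrow> ('a \<Rightarrow> real) \<Rightarrow> bool"
  where "C1_in W f \<longleftrightarrow> (\<forall>c\<in>A. C1_on (snd c ` (fst c \<inter> W)) (f \<circ> chart_inv c))"

lemma C1_in_UNIV: "C1_in UNIV f \<longleftrightarrow> C1_function A f"
  by (simp add: C1_in_def C1_function_def C1_on_def)

lemma C1_functionD: "C1_function A f \<Longrightarrow> c \<in> A \<Longrightarrow> C1_on (img c) (f \<circ> chart_inv c)"
  by (simp add: C1_function_def C1_on_def)

lemma C1_in_subset: "C1_in W f \<Longrightarrow> U \<subseteq> W \<Longrightarrow> C1_in U f"
  unfolding C1_in_def by (meson C1_on_subset Int_mono image_mono order_refl)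

lemma C1_in_Un:
  assumes "open U" "open W" "C1_in U f" "C1_in W f"
  shows "C1_in (U \<union> W) f"
  unfolding C1_in_def
proof
  fix c assume c: "c \<in> A"
  let ?P = "\<lambda>X. snd c ` (fst c \<inter> X)"
  show "C1_on (?P (U \<union> W)) (f \<circ> chart_inv c)"
  proof (rule C1_on_local)
    fix y assume "y \<in> ?P (U \<union> W)"
    then have "y \<in> ?P U \<or> y \<in> ?P W" by auto
    moreover have "?P (U \<union> W) \<inter> ?P X = ?P X" if "X \<subseteq> U \<union> W" for X using that by auto
    ultimately show "\<exists>N. open N \<and> y \<in> N \<and> C1_on (?P (U \<union> W) \<inter> N) (f \<circ> chart_inv c)"
      using assms open_chart_image[OF c] c unfolding C1_in_def
      by (metis Un_upper1 Un_upper2)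
  qed
qed

lemma C1_in_cong:
  assumes "open W" "\<And>x. x \<in> W \<Longrightarrow> f x = h x" "C1_in W h"
  shows "C1_in W f"
  unfolding C1_in_def
proof
  fix c assume c: "c \<in> A"
  show "C1_on (snd c ` (fst c \<inter> W)) (f \<circ> chart_inv c)"
    by (rule C1_on_cong[OF open_chart_image[OF c assms(1)], of _ "h \<circ> chart_inv c"])
      (use assms c chart_inv_chart[OF c] in \<open>auto simp: C1_in_def\<close>)
qed

lemma C1_in_const: "C1_in W (\<lambda>x. c)"
  by (simp add: C1_in_def o_def C1_on_const)

lemma C1_in_add: "C1_in W f \<Longrightarrow> C1_in W h \<Longrightarrow> C1_in W (\<lambda>x. f x + h x)"
  by (simp add: C1_in_def o_def C1_on_add)

lemma C1_in_mult: "C1_in W f \<Longrightarrow> C1_in W h \<Longrightarrow> C1_in W (\<lambda>x. f x * h x)"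
  by (simp add: C1_in_def o_def C1_on_mult)

lemma C1_in_sum: "(\<And>i. i \<in> I \<Longrightarrow> C1_in W (f i)) \<Longrightarrow> C1_in W (\<lambda>x. \<Sum>i\<in>I. f i x)"
  by (simp add: C1_in_def o_def C1_on_sum)

lemma C1_in_compose_real:
  assumes "C1_in W f" "\<And>t. t \<in> T \<Longrightarrow> (q has_real_derivative q' t) (at t)" "continuous_on T q'"
    and "\<And>x. x \<in> W \<Longrightarrow> f x \<in> T"
  shows "C1_in W (\<lambda>x. q (f x))"
  unfolding C1_in_def o_def
proof
  fix c assume c: "c \<in> A"
  show "C1_on (snd c ` (fst c \<inter> W)) (\<lambda>x. q (f (chart_inv c x)))"
    by (rule C1_on_compose_real[OF _ assms(2,3)])
      (use assms c chart_inv_chart[OF c] in \<open>auto simp: C1_in_def o_def\<close>)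
qed

lemma C1_function_imp_continuous_on:
  assumes "C1_function A f"
  shows "continuous_on UNIV f"
  by (rule continuous_on_charts, rule continuous_on_chart_domain[OF _ order_refl])
    (use assms in \<open>blast intro: C1_on_imp_continuous_on C1_functionD\<close>)+

text \<open>The profile \<open>q\<close>, the square of the positive part of
  \<open>r\<^sup>2 - t\<close>, is applied to the squared coordinate distance from the image of
  \<open>\<theta>\<close>. In any other chart this is the same expression composed with a transition
  map, hence C1. Off \<open>K\<close>, which is closed because the space is Hausdorff, the function
  is zero, and the chart domain and \<open>- K\<close> cover the manifold.\<close>

lemma bump_exists:
  assumes c: "c \<in> A" and W: "open W" "W \<subseteq> fst c" and \<theta>: "\<theta> \<in> W"
  obtains b K where "C1_function A b" "compact K" "K \<subseteq> W" "\<And>x. x \<notin> K \<Longrightarrow> b x = 0"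
    "\<And>x. b x \<ge> 0" "b \<theta> > 0"
proof -
  let ?y = "snd c \<theta>"
  have "fst c \<inter> W = W" using W by auto
  then have "open (snd c ` W)" using open_chart_image[OF c W(1)] by simp
  then obtain r where r: "r > 0" "cball ?y r \<subseteq> snd c ` W"
    using \<theta> by (meson imageI open_contains_cball)
  define K where "K = chart_inv c ` cball ?y r"
  have sub: "cball ?y r \<subseteq> img c" using r W by auto
  have K: "compact K"
    unfolding K_def by (intro compact_continuous_image continuous_on_subset[OF continuous_chart_inv[OF c] sub]) auto
  have KW: "K \<subseteq> W" unfolding K_def using r W chart_inv_chart[OF c] by force
  define q where "q = (\<lambda>t. (max 0 (r\<^sup>2 - t))\<^sup>2)"
  have q': "(q has_real_derivative - (2 * max 0 (r\<^sup>2 - t))) (at t)" for t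
  proof -
    have "((\<lambda>t. r\<^sup>2 - t) has_real_derivative - 1) (at t)" by (auto intro!: derivative_eq_intros)
    from DERIV_chain2[OF DERIV_max_0_power2 this] show ?thesis by (simp add: q_def)
  qed
  define b where "b = (\<lambda>x. if x \<in> fst c then q ((snd c x - ?y) \<bullet> (snd c x - ?y)) else 0)"
  have b0: "b x = 0" if "x \<notin> K" for x
  proof (cases "x \<in> fst c")
    case True
    have "snd c x \<notin> cball ?y r"
      using that chart_inv_chart[OF c True] unfolding K_def by (metis imageI)
    then have "norm (snd c x - ?y) \<ge> r" by (simp add: dist_norm norm_minus_commute)
    then have "(norm (snd c x - ?y))\<^sup>2 \<ge> r\<^sup>2" using r by (intro power_mono) auto
    then show ?thesis by (simp add: b_def q_def power2_norm_eq_inner)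
  qed (simp add: b_def)
  have "C1_in (fst c) b"
    unfolding C1_in_def
  proof
    fix d assume d: "d \<in> A"
    let ?S = "snd d ` (fst d \<inter> fst c)"
    have t: "C1_on ?S (\<lambda>y. transition d c y + (- ?y))"
      by (intro C1_on_add C1_on_const C1_transition c d)
    have "C1_on ?S (\<lambda>y. q ((transition d c y + (- ?y)) \<bullet> (transition d c y + (- ?y))))"
      by (rule C1_on_compose_real[where T=UNIV, OF C1_on_bounded_bilinear[OF bounded_bilinear_inner t t] q'])
        (auto intro!: continuous_intros)
    then show "C1_on ?S (b \<circ> chart_inv d)"
      by (rule C1_on_cong[OF open_chart_image[OF d open_domain[OF c]], rotated])
        (auto simp: b_def transition_def chart_inv_chart[OF d])
  qed
  moreover have "C1_in (- K) b"
    by (rule C1_in_cong[OF _ _ C1_in_const[of _ 0]]) (use b0 compact_imp_closed[OF K] in auto)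
  ultimately have "C1_in (fst c \<union> - K) b"
    using compact_imp_closed[OF K] by (intro C1_in_Un open_domain[OF c]) auto
  moreover have "fst c \<union> - K = UNIV" using KW W by auto
  ultimately have "C1_function A b" by (simp add: C1_in_UNIV)
  moreover have "b \<theta> > 0" using \<theta> W r by (auto simp: b_def q_def)
  moreover have "b x \<ge> 0" for x by (simp add: b_def q_def)
  ultimately show ?thesis using that K KW b0 by blast
qed

section \<open>The derivative of a function along the vector field\<close>

definition D :: "('a \<Rightarrow> real) \<Rightarrow> 'a \<Rightarrow> real"
  where "D f \<theta> = V (chart_at A \<theta>) \<theta> \<bullet> coord_deriv (chart_at A \<theta>) f \<theta>"

lemma inner_coord_deriv:
  assumes "f \<circ> chart_inv c differentiable at (snd c \<theta>)"
  shows "v \<bullet> coord_deriv c f \<theta> = frechet_derivative (f \<circ> chart_inv c) (at (snd c \<theta>)) v"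
proof -
  let ?L = "frechet_derivative (f \<circ> chart_inv c) (at (snd c \<theta>))"
  have L: "linear ?L" by (rule linear_frechet_derivative[OF assms])
  have "?L v = ?L (\<Sum>\<mu>\<in>UNIV. v $ \<mu> *\<^sub>R axis \<mu> 1)"
    by (simp only: scalar_mult_eq_scaleR[symmetric] basis_expansion)
  also have "\<dots> = (\<Sum>\<mu>\<in>UNIV. v $ \<mu> * ?L (axis \<mu> 1))"
    by (simp add: linear_sum[OF L] linear_scale[OF L])
  finally show ?thesis by (simp add: coord_deriv_def inner_vec_def)
qed

text \<open>Frees \<open>D\<close> from the chart chosen by \<open>chart_at\<close>: the chain rule
  through the transition map on the one side matches the transformation law of the components of
  \<open>V\<close> on the other.\<close>

lemma D_eq_frechet:
  assumes f: "C1_function A f" and c: "c \<in> A" and \<theta>: "\<theta> \<in> fst c"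
  shows "D f \<theta> = frechet_derivative (f \<circ> chart_inv c) (at (snd c \<theta>)) (V c \<theta>)"
proof -
  define d where "d = chart_at A \<theta>"
  have d: "d \<in> A" "\<theta> \<in> fst d" using chart_at_props by (auto simp: d_def)
  have fd: "(f \<circ> chart_inv c') differentiable at (snd c' \<theta>)" if "c' \<in> A" "\<theta> \<in> fst c'" for c'
    using C1_functionD[OF f that(1)] that unfolding C1_on_iff by auto
  let ?S = "snd d ` (fst d \<inter> fst c)"
  have td: "transition d c differentiable at (snd d \<theta>)"
    using C1_transition[OF d(1) c] d \<theta> unfolding C1_on_iff by auto
  have tc: "transition d c (snd d \<theta>) = snd c \<theta>"
    using d by (simp add: transition_def chart_inv_chart)
  have "frechet_derivative (f \<circ> chart_inv d) (at (snd d \<theta>))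
      = frechet_derivative ((f \<circ> chart_inv c) \<circ> transition d c) (at (snd d \<theta>))"
    by (rule frechet_derivative_transform_within_open[OF fd[OF d] open_chart_image[OF d(1) open_domain[OF c]]])
      (use d \<theta> c in \<open>auto simp: transition_def chart_inv_chart\<close>)
  also have "\<dots> = frechet_derivative (f \<circ> chart_inv c) (at (snd c \<theta>)) \<circ> frechet_derivative (transition d c) (at (snd d \<theta>))"
    using frechet_derivative_compose[OF td, of "f \<circ> chart_inv c"] fd[OF c \<theta>] by (simp add: tc)
  finally have "frechet_derivative (f \<circ> chart_inv d) (at (snd d \<theta>)) (V d \<theta>)
     = frechet_derivative (f \<circ> chart_inv c) (at (snd c \<theta>)) (frechet_derivative (transition d c) (at (snd d \<theta>)) (V d \<theta>))"
    by (simp only: o_apply)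
  moreover have "V c \<theta> = frechet_derivative (transition d c) (at (snd d \<theta>)) (V d \<theta>)"
    using field c d \<theta> unfolding C1_vector_field_def vector_field_def by blast
  ultimately show ?thesis
    unfolding D_def d_def[symmetric] inner_coord_deriv[OF fd[OF d]] by (simp only:)
qed

lemma D_eq_coord:
  assumes f: "C1_function A f" and c: "c \<in> A" and \<theta>: "\<theta> \<in> fst c"
  shows "D f \<theta> = V c \<theta> \<bullet> coord_deriv c f \<theta>"
  using D_eq_frechet[OF assms] inner_coord_deriv[of f c \<theta>] C1_functionD[OF f c] \<theta>
  unfolding C1_on_iff by auto

lemma C1_function_mult: "C1_function A f \<Longrightarrow> C1_function A h \<Longrightarrow> C1_function A (\<lambda>x. f x * h x)"
  using C1_in_mult[of UNIV f h] by (simp add: C1_in_UNIV)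

lemma C1_function_add: "C1_function A f \<Longrightarrow> C1_function A h \<Longrightarrow> C1_function A (\<lambda>x. f x + h x)"
  using C1_in_add[of UNIV f h] by (simp add: C1_in_UNIV)

lemma C1_function_sum: "(\<And>i. i \<in> I \<Longrightarrow> C1_function A (f i)) \<Longrightarrow> C1_function A (\<lambda>x. \<Sum>i\<in>I. f i x)"
  using C1_in_sum[of I UNIV f] by (simp add: C1_in_UNIV)

lemma C1_function_const: "C1_function A (\<lambda>x. c)"
  using C1_in_const[of UNIV c] by (simp add: C1_in_UNIV)

lemma C1_function_compose_real:
  assumes "C1_function A f" "\<And>t. t \<in> T \<Longrightarrow> (q has_real_derivative q' t) (at t)" "continuous_on T q'"
    and "\<And>x. f x \<in> T"
  shows "C1_function A (\<lambda>x. q (f x))"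
  using C1_in_compose_real[of UNIV f T q q'] assms by (simp add: C1_in_UNIV)

lemma has_derivative_chart:
  assumes "C1_function A f"
  shows "((\<lambda>y. f (chart_inv (chart_at A \<theta>) y)) has_derivative
    frechet_derivative (f \<circ> chart_inv (chart_at A \<theta>)) (at (snd (chart_at A \<theta>) \<theta>))) (at (snd (chart_at A \<theta>) \<theta>))"
  using C1_onD(1)[OF C1_functionD[OF assms chart_at_props(1)]] chart_at_props(2) by (auto simp: o_def)

text \<open>Any Frechet derivative of the coordinate representative may be used to compute
  \<open>D\<close>, so the sum, product and chain rules for \<open>D\<close> reduce to those on
  Euclidean space.\<close>

lemma D_eqI:
  assumes "C1_function A f"
    and "((\<lambda>y. f (chart_inv (chart_at A \<theta>) y)) has_derivative L) (at (snd (chart_at A \<theta>) \<theta>))"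
  shows "D f \<theta> = L (V (chart_at A \<theta>) \<theta>)"
  using D_eq_frechet[OF assms(1) chart_at_props] frechet_derivative_at[OF assms(2)] by (simp add: o_def)

lemma D_mult:
  assumes "C1_function A f" "C1_function A h"
  shows "D (\<lambda>x. f x * h x) \<theta> = f \<theta> * D h \<theta> + h \<theta> * D f \<theta>"
  using D_eqI[OF C1_function_mult[OF assms] has_derivative_mult[OF assms[THEN has_derivative_chart]]]
    chart_inv_chart[OF chart_at_props] D_eq_frechet[OF _ chart_at_props] assms by simp

lemma D_add:
  assumes "C1_function A f" "C1_function A h"
  shows "D (\<lambda>x. f x + h x) \<theta> = D f \<theta> + D h \<theta>"
  using D_eqI[OF C1_function_add[OF assms] has_derivative_add[OF assms[THEN has_derivative_chart]]]
    D_eq_frechet[OF _ chart_at_props] assms by simp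

lemma D_compose_real:
  assumes f: "C1_function A f" and q: "\<And>t. t \<in> T \<Longrightarrow> (q has_real_derivative q' t) (at t)" "continuous_on T q'"
    and T: "\<And>x. f x \<in> T"
  shows "D (\<lambda>x. q (f x)) \<theta> = q' (f \<theta>) * D f \<theta>"
  using D_eqI[OF C1_function_compose_real[OF assms]
      has_derivative_compose[OF has_derivative_chart[OF f] q(1)[OF T, unfolded has_field_derivative_def]]]
    chart_inv_chart[OF chart_at_props] D_eq_frechet[OF f chart_at_props] by simp

lemma D_eq_0_outside:
  assumes "C1_function A f" "closed K" "\<And>x. x \<notin> K \<Longrightarrow> f x = 0" "\<theta> \<notin> K"
  shows "D f \<theta> = 0"
proof -
  let ?c = "chart_at A \<theta>"
  have "((\<lambda>y. f (chart_inv ?c y)) has_derivative (\<lambda>_. 0)) (at (snd ?c \<theta>))"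
    by (rule has_derivative_transform_within_open[OF has_derivative_const[of 0]
          open_chart_image[OF chart_at_props(1), of "- K"]])
      (use assms chart_at_props chart_inv_chart[OF chart_at_props(1)] in auto)
  from D_eqI[OF assms(1) this] show ?thesis .
qed

lemma C1_V: "c \<in> A \<Longrightarrow> C1_on (img c) (V c \<circ> chart_inv c)"
  using field by (simp add: C1_vector_field_def C1_on_def)

lemma continuous_on_D:
  assumes "C1_function A f"
  shows "continuous_on UNIV (D f)"
proof (rule continuous_on_charts)
  fix c assume c: "c \<in> A"
  have "continuous_on (img c) (\<lambda>y. (V c \<circ> chart_inv c) y \<bullet>
      (\<chi> \<mu>. frechet_derivative (f \<circ> chart_inv c) (at y) (axis \<mu> 1)))"
    by (intro continuous_on_inner C1_on_imp_continuous_on[OF C1_V[OF c]]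
        continuous_on_vec_lambda C1_onD(2)[OF C1_functionD[OF assms c]])
  then have "continuous_on (img c) (D f \<circ> chart_inv c)"
    by (rule continuous_on_eq)
      (use chart_inv_in[OF c] chart_chart_inv[OF c] D_eq_coord[OF assms c] in \<open>auto simp: coord_deriv_def\<close>)
  then show "continuous_on (fst c) (D f)"
    by (rule continuous_on_chart_domain[OF c order_refl])
qed

section \<open>The Riemannian volume in coordinates\<close>

lemma det_metric_pos: "c \<in> A \<Longrightarrow> \<theta> \<in> fst c \<Longrightarrow> det (g c \<theta>) > 0"
  using metric by (intro det_pos_definite) (auto simp: riemannian_metric_def)

definition vdens :: "('a, 'p) chart \<Rightarrow> real ^ 'p \<Rightarrow> real"
  where "vdens c y = sqrt (det (g c (chart_inv c y)))"

lemma vdens_pos: "c \<in> A \<Longrightarrow> y \<in> img c \<Longrightarrow> vdens c y > 0"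
  using det_metric_pos chart_inv_in by (simp add: vdens_def)

text \<open>The determinant is a polynomial in the metric coefficients, and positive definiteness
  keeps it in the range where the square root is differentiable.\<close>

lemma C1_vdens:
  assumes c: "c \<in> A"
  shows "C1_on (img c) (vdens c)"
  unfolding vdens_def[abs_def]
proof (rule C1_on_compose_real[where q=sqrt and f="\<lambda>y. det (g c (chart_inv c y))" and T="{0<..}"
      and q'="\<lambda>t. inverse (sqrt t) / 2"])
  show "C1_on (img c) (\<lambda>y. det (g c (chart_inv c y)))"
  proof (rule C1_on_det)
    show "C1_on (img c) (\<lambda>y. g c (chart_inv c y) $ i $ j)" for i j
      using metric c unfolding riemannian_metric_def smooth_on_def C1_on_def by blast
  qed
  show "(sqrt has_real_derivative inverse (sqrt t) / 2) (at t)" if "t \<in> {0<..}" for t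
    using that by (intro DERIV_real_sqrt) auto
  show "continuous_on {0<..} (\<lambda>t. inverse (sqrt t) / 2)"
    by (intro continuous_intros) auto
  show "det (g c (chart_inv c y)) \<in> {0<..}" if "y \<in> img c" for y
    using det_metric_pos[OF c chart_inv_in[OF c that]] by simp
qed

lemma sets_vol [measurable_cong]: "sets vol = sets borel"
  using volume by (simp add: riemannian_volume_def)

text \<open>The volume is specified by its values on sets; as an equation between measures this
  makes the general rules for integrals over \<open>density\<close> and \<open>distr\<close>
  applicable. The inverse chart is completed by the constant \<open>undefined\<close> to a Borel map
  on the whole coordinate space; those values carry no mass, since the density is zero off the image
  of the chart.\<close>

lemma vol_restrict_chart:
  assumes c: "c \<in> A"
  defines "k \<equiv> \<lambda>y. if y \<in> img c then chart_inv c y else undefined"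
  shows "k \<in> borel_measurable borel"
    and "density vol (\<lambda>\<theta>. indicator (fst c) \<theta>)
      = distr (density lborel (\<lambda>y. ennreal (indicator (img c) y * vdens c y))) borel k"
proof -
  have img[measurable]: "img c \<in> sets borel" using open_img[OF c] by simp
  have dom[measurable]: "fst c \<in> sets borel" using open_domain[OF c] by simp
  show k[measurable]: "k \<in> borel_measurable borel"
    unfolding k_def by (intro borel_measurable_continuous_on_if continuous_chart_inv[OF c]) auto
  have vm[measurable]: "(\<lambda>y. indicator (img c) y * vdens c y) \<in> borel_measurable borel"
    using borel_measurable_continuous_on_indicator[OF img C1_on_imp_continuous_on[OF C1_vdens[OF c]]] by simp
  show "density vol (\<lambda>\<theta>. indicator (fst c) \<theta>)
      = distr (density lborel (\<lambda>y. ennreal (indicator (img c) y * vdens c y))) borel k" (is "?l = ?r")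
  proof (rule measure_eqI)
    show "sets ?l = sets ?r" by (simp add: sets_vol)
    fix B assume "B \<in> sets ?l"
    then have B[measurable]: "B \<in> sets borel" by (simp add: sets_vol)
    have "emeasure ?l B = emeasure vol (B \<inter> fst c)"
      by (subst emeasure_restricted) (auto simp: sets_vol Int_commute)
    also have "\<dots> = (\<integral>\<^sup>+y\<in>snd c ` (B \<inter> fst c). ennreal (vdens c y) \<partial>lborel)"
    proof -
      have "\<forall>B\<in>sets borel. B \<subseteq> fst c \<longrightarrow>
          emeasure vol B = (\<integral>\<^sup>+y\<in>snd c ` B. ennreal (vdens c y) \<partial>lborel)"
        using bspec[OF conjunct2[OF volume[unfolded riemannian_volume_def]] c] by (simp only: vdens_def)
      from this[rule_format, of "B \<inter> fst c"] show ?thesis by simp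
    qed
    also have "\<dots> = (\<integral>\<^sup>+y. ennreal (indicator (img c) y * vdens c y) * indicator (k -` B) y \<partial>lborel)"
    proof (rule nn_integral_cong)
      fix y :: "real ^ 'p"
      have "y \<in> snd c ` (B \<inter> fst c) \<longleftrightarrow> y \<in> img c \<and> k y \<in> B"
        using chart_inv_chart[OF c] chart_inv_in[OF c] chart_chart_inv[OF c]
        unfolding k_def by (auto simp: image_iff)
      then show "ennreal (vdens c y) * indicator (snd c ` (B \<inter> fst c)) y
        = ennreal (indicator (img c) y * vdens c y) * indicator (k -` B) y"
        by (auto simp: indicator_def)
    qed
    also have "\<dots> = emeasure ?r B"
      by (subst emeasure_distr, simp, simp, subst emeasure_density) (auto intro!: measurable_sets_borel[OF k])
    finally show "emeasure ?l B = emeasure ?r B" .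
  qed
qed

lemma vol_integral_chart:
  fixes h :: "'a \<Rightarrow> real"
  assumes c: "c \<in> A" and h[measurable]: "h \<in> borel_measurable borel" and h0: "\<And>\<theta>. \<theta> \<notin> fst c \<Longrightarrow> h \<theta> = 0"
  shows "integrable vol h \<longleftrightarrow> integrable lborel (\<lambda>y. indicator (img c) y * (vdens c y * h (chart_inv c y)))"
    and "(\<integral>\<theta>. h \<theta> \<partial>vol) = (\<integral>y. indicator (img c) y * (vdens c y * h (chart_inv c y)) \<partial>lborel)"
proof -
  define k where "k = (\<lambda>y. if y \<in> img c then chart_inv c y else undefined)"
  note vr = vol_restrict_chart[OF c, folded k_def]
  note k[measurable] = vr(1)
  have img[measurable]: "img c \<in> sets borel" using open_img[OF c] by simp
  have dom[measurable]: "fst c \<in> sets borel" using open_domain[OF c] by simp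
  have vm[measurable]: "(\<lambda>y. indicator (img c) y * vdens c y) \<in> borel_measurable borel"
    using borel_measurable_continuous_on_indicator[OF img C1_on_imp_continuous_on[OF C1_vdens[OF c]]] by simp
  have vp: "0 \<le> indicator (img c) y * vdens c y" for y
    using vdens_pos[OF c, of y] by (auto simp: indicator_def)
  have e1: "(\<lambda>\<theta>. indicator (fst c) \<theta> *\<^sub>R h \<theta>) = h" using h0 by (auto simp: indicator_def fun_eq_iff)
  have e2: "(\<lambda>y. (indicator (img c) y * vdens c y) *\<^sub>R h (k y))
      = (\<lambda>y. indicator (img c) y * (vdens c y * h (chart_inv c y)))"
    by (auto simp: indicator_def fun_eq_iff k_def)
  let ?l = "density vol (\<lambda>\<theta>. ennreal (indicator (fst c) \<theta>))"
  have l: "?l = distr (density lborel (\<lambda>y. ennreal (indicator (img c) y * vdens c y))) borel k"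
    using vr(2) by (simp add: ennreal_indicator)
  have "integrable vol h \<longleftrightarrow> integrable ?l h"
    by (subst integrable_density) (auto simp: e1[simplified])
  also have "\<dots> \<longleftrightarrow> integrable lborel (\<lambda>y. indicator (img c) y * (vdens c y * h (chart_inv c y)))"
    unfolding l e2[symmetric] using vp
    by (subst integrable_distr_eq, simp, simp, subst integrable_density) auto
  finally show "integrable vol h \<longleftrightarrow> integrable lborel (\<lambda>y. indicator (img c) y * (vdens c y * h (chart_inv c y)))" .
  have "(\<integral>\<theta>. h \<theta> \<partial>vol) = (\<integral>\<theta>. h \<theta> \<partial>?l)"
    by (subst integral_density) (auto simp: e1[simplified])
  also have "\<dots> = (\<integral>y. indicator (img c) y * (vdens c y * h (chart_inv c y)) \<partial>lborel)"
    unfolding l e2[symmetric] using vp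
    by (subst integral_distr, simp, simp, subst integral_density) auto
  finally show "(\<integral>\<theta>. h \<theta> \<partial>vol) = (\<integral>y. indicator (img c) y * (vdens c y * h (chart_inv c y)) \<partial>lborel)" .
qed

subsection \<open>The divergence theorem\<close>

text \<open>The formula for the divergence in a prescribed chart. It is kept apart from
  \<open>divergence\<close>, which picks the chart, until both are known to agree on the whole chart
  domain.\<close>

definition divc :: "('a, 'p) chart \<Rightarrow> 'a \<Rightarrow> real"
  where "divc c \<theta> = (\<Sum>\<mu>\<in>UNIV. coord_deriv c (\<lambda>t. sqrt (det (g c t)) * V c t $ \<mu>) \<theta> $ \<mu>)
    / sqrt (det (g c \<theta>))"

lemma divergence_eq_divc: "divergence A g V \<theta> = divc (chart_at A \<theta>) \<theta>"
  by (simp add: divergence_def divc_def Let_def)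

lemma C1_vdens_V:
  assumes c: "c \<in> A"
  shows "C1_on (img c) (\<lambda>y. vdens c y * V c (chart_inv c y) $ \<mu>)"
  using C1_on_mult[OF C1_vdens[OF c] C1_on_bounded_linear[OF bounded_linear_vec_nth C1_V[OF c]]]
  by (simp add: o_def)

text \<open>Multiplying by the volume density clears the denominator and leaves a Euclidean
  divergence, which is the form that meets the factor \<open>vdens c\<close> in the change of
  variables.\<close>

lemma divc_in_chart:
  assumes c: "c \<in> A" and y: "y \<in> img c"
  shows "vdens c y * divc c (chart_inv c y)
    = (\<Sum>\<mu>\<in>UNIV. frechet_derivative (\<lambda>y. vdens c y * V c (chart_inv c y) $ \<mu>) (at y) (axis \<mu> 1))"
  using vdens_pos[OF c y] chart_chart_inv[OF c y]
  by (simp add: divc_def coord_deriv_def o_def vdens_def)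

lemma continuous_on_divc:
  assumes c: "c \<in> A"
  shows "continuous_on (fst c) (divc c)"
proof (rule continuous_on_chart_domain[OF c order_refl])
  have "continuous_on (img c) (\<lambda>y. (\<Sum>\<mu>\<in>UNIV. frechet_derivative (\<lambda>y. vdens c y * V c (chart_inv c y) $ \<mu>) (at y) (axis \<mu> 1)) / vdens c y)"
    using vdens_pos[OF c]
    by (intro continuous_on_divide continuous_on_sum C1_onD(2)[OF C1_vdens_V[OF c]]
        C1_on_imp_continuous_on[OF C1_vdens[OF c]]) force
  then show "continuous_on (img c) (divc c \<circ> chart_inv c)"
    by (rule continuous_on_eq) (use vdens_pos[OF c] in \<open>force simp flip: divc_in_chart[OF c]\<close>)
qed

text \<open>In coordinates the integrand times the volume density is the Euclidean divergence of
  \<open>u\<close> times \<open>vdens c\<close> times \<open>V\<close>. Extended by zero this field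
  is C1 with compact support, so each of its partial derivatives has integral zero.\<close>

lemma integration_by_parts_chart:
  assumes c: "c \<in> A" and u: "C1_function A u" and K: "compact K" "K \<subseteq> fst c" "\<And>x. x \<notin> K \<Longrightarrow> u x = 0"
  shows "integrable vol (\<lambda>\<theta>. D u \<theta> + u \<theta> * divc c \<theta>)"
    and "(\<integral>\<theta>. D u \<theta> + u \<theta> * divc c \<theta> \<partial>vol) = 0"
proof -
  let ?h = "\<lambda>\<theta>. D u \<theta> + u \<theta> * divc c \<theta>"
  note clK = compact_imp_closed[OF K(1)]
  have h0: "?h \<theta> = 0" if "\<theta> \<notin> K" for \<theta>
    using D_eq_0_outside[OF u clK K(3) that] K(3)[OF that] by simp
  have hc: "continuous_on UNIV ?h"
    by (rule continuous_on_zero_extension[OF open_domain[OF c] clK K(2) _ h0])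
      (intro continuous_intros continuous_on_divc[OF c] continuous_on_subset[OF continuous_on_D[OF u]]
        continuous_on_subset[OF C1_function_imp_continuous_on[OF u]]; simp)
  define K' where "K' = snd c ` K"
  have K': "compact K'" "K' \<subseteq> img c"
    unfolding K'_def using K continuous_on_subset[OF continuous_chart[OF c]]
    by (auto intro!: compact_continuous_image)
  have K'0: "u (chart_inv c y) = 0" if "y \<in> img c" "y \<notin> K'" for y
    using that chart_chart_inv[OF c] K(3) unfolding K'_def by (metis imageI)
  \<comment> \<open>The zero extension stays C1 at the boundary of the chart image, because
    \<open>K'\<close> is a compact subset of that open image and the field vanishes off
    \<open>K'\<close>.\<close>
  define G where "G = (\<lambda>\<mu> y. if y \<in> img c
    then u (chart_inv c y) * (vdens c y * V c (chart_inv c y) $ \<mu>) else 0)"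
  have uc: "C1_on (img c) (\<lambda>y. u (chart_inv c y))" using C1_functionD[OF u c] by (simp add: o_def)
  have G1: "C1_on (img c) (\<lambda>y. u (chart_inv c y) * (vdens c y * V c (chart_inv c y) $ \<mu>))" for \<mu>
    by (rule C1_on_mult[OF uc C1_vdens_V[OF c]])
  have G1': "C1_on (img c) (G \<mu>)" for \<mu>
    by (rule C1_on_cong[OF open_img[OF c] _ G1[of \<mu>]]) (simp add: G_def)
  have G0: "G \<mu> y = 0" if "y \<notin> K'" for \<mu> y using K'0[OF _ that] by (simp add: G_def)
  have G2: "C1_on (- K') (G \<mu>)" for \<mu>
    by (rule C1_on_cong[OF _ _ C1_on_const[of _ 0]]) (use G0 compact_imp_closed[OF K'(1)] in auto)
  have GC1: "C1_on UNIV (G \<mu>)" for \<mu>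
  proof (rule C1_on_local)
    fix y :: "real ^ 'p"
    show "\<exists>U. open U \<and> y \<in> U \<and> C1_on (UNIV \<inter> U) (G \<mu>)"
    proof (cases "y \<in> img c")
      case True then show ?thesis using G1' open_img[OF c] by auto
    next
      case False
      then have "y \<in> - K'" "open (- K')" using K' compact_imp_closed by auto
      then show ?thesis using G2 by auto
    qed
  qed
  have int: "integrable lborel (\<lambda>y. frechet_derivative (G \<mu>) (at y) (axis \<mu> 1))" for \<mu>
    by (rule continuous_compact_support_integrable[OF C1_onD(2)[OF GC1] K'(1)])
      (simp add: frechet_derivative_eq_0_outside[OF compact_imp_closed[OF K'(1)] G0])
  \<comment> \<open>The product rule separates \<open>G\<close> into the derivative of
    \<open>u\<close> along \<open>V\<close>, weighted by \<open>vdens c\<close>, and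
    \<open>u\<close> times the Euclidean divergence of \<open>vdens c\<close> times
    \<open>V\<close>.\<close>
  have key: "indicator (img c) y * (vdens c y * ?h (chart_inv c y))
      = (\<Sum>\<mu>\<in>UNIV. frechet_derivative (G \<mu>) (at y) (axis \<mu> 1))" for y
  proof (cases "y \<in> img c")
    case False
    then have "y \<notin> K'" using K' by auto
    then show ?thesis
      using False by (simp add: frechet_derivative_eq_0_outside[OF compact_imp_closed[OF K'(1)] G0])
  next
    case True
    let ?R = "\<lambda>\<mu> y. vdens c y * V c (chart_inv c y) $ \<mu>"
    have "frechet_derivative (G \<mu>) (at y) = (\<lambda>v. u (chart_inv c y) * frechet_derivative (?R \<mu>) (at y) v
        + frechet_derivative (\<lambda>y. u (chart_inv c y)) (at y) v * ?R \<mu> y)" for \<mu>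
    proof -
      have "((\<lambda>y. u (chart_inv c y) * ?R \<mu> y) has_derivative
        (\<lambda>v. u (chart_inv c y) * frechet_derivative (?R \<mu>) (at y) v
        + frechet_derivative (\<lambda>y. u (chart_inv c y)) (at y) v * ?R \<mu> y)) (at y)"
        by (rule has_derivative_mult[OF C1_onD(1)[OF uc True] C1_onD(1)[OF C1_vdens_V[OF c] True]])
      then have "(G \<mu> has_derivative
        (\<lambda>v. u (chart_inv c y) * frechet_derivative (?R \<mu>) (at y) v
        + frechet_derivative (\<lambda>y. u (chart_inv c y)) (at y) v * ?R \<mu> y)) (at y)"
        by (rule has_derivative_transform_within_open[OF _ open_img[OF c] True]) (simp add: G_def)
      then show ?thesis by (rule frechet_derivative_at[symmetric])
    qed
    then have "(\<Sum>\<mu>\<in>UNIV. frechet_derivative (G \<mu>) (at y) (axis \<mu> 1))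
      = u (chart_inv c y) * (\<Sum>\<mu>\<in>UNIV. frechet_derivative (?R \<mu>) (at y) (axis \<mu> 1))
        + vdens c y * (\<Sum>\<mu>\<in>UNIV. V c (chart_inv c y) $ \<mu> * frechet_derivative (\<lambda>y. u (chart_inv c y)) (at y) (axis \<mu> 1))"
      by (simp add: sum.distrib sum_distrib_left mult_ac)
    also have "(\<Sum>\<mu>\<in>UNIV. V c (chart_inv c y) $ \<mu> * frechet_derivative (\<lambda>y. u (chart_inv c y)) (at y) (axis \<mu> 1))
      = D u (chart_inv c y)"
      using D_eq_coord[OF u c chart_inv_in[OF c True]] chart_chart_inv[OF c True]
      by (simp add: coord_deriv_def inner_vec_def o_def)
    finally show ?thesis
      using True divc_in_chart[OF c True] by (simp add: algebra_simps)
  qed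
  have hm: "?h \<in> borel_measurable borel" by (rule borel_measurable_continuous_onI[OF hc])
  have out: "\<And>\<theta>. \<theta> \<notin> fst c \<Longrightarrow> ?h \<theta> = 0" using h0 K(2) by blast
  show "integrable vol ?h"
    by (subst vol_integral_chart(1)[OF c hm]) (use out in blast, unfold key, intro Bochner_Integration.integrable_sum int)
  have "(\<integral>y. frechet_derivative (G \<mu>) (at y) (axis \<mu> 1) \<partial>lborel) = 0" for \<mu>
    using integral_derivative_compact_support[OF GC1 K'(1)] G0 by blast
  then show "(\<integral>\<theta>. ?h \<theta> \<partial>vol) = 0"
    by (subst vol_integral_chart(2)[OF c hm])
      (use out in blast, unfold key, simp add: Bochner_Integration.integral_sum int)
qed

lemma space_vol: "space vol = UNIV"
  using sets_eq_imp_space_eq[OF sets_vol] by simp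

text \<open>A strictly positive density on a nonempty open set of coordinates, which is not Lebesgue
  null. This lets an almost everywhere statement contradict a strict inequality valid on an open
  set.\<close>

lemma emeasure_vol_open_pos:
  assumes c: "c \<in> A" and W: "open W" "W \<subseteq> fst c" "W \<noteq> {}"
  shows "emeasure vol W \<noteq> 0"
proof
  assume *: "emeasure vol W = 0"
  have op: "open (snd c ` W)" using open_chart_image[OF c W(1)] W(2) by (simp add: Int_absorb1)
  have "emeasure vol W = (\<integral>\<^sup>+y\<in>snd c ` W. ennreal (vdens c y) \<partial>lborel)"
    using bspec[OF conjunct2[OF volume[unfolded riemannian_volume_def]] c, rule_format, of W] W
    by (simp add: vdens_def)
  also have "\<dots> = (\<integral>\<^sup>+y. ennreal (indicator (snd c ` W) y * vdens c y) \<partial>lborel)"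
    by (intro nn_integral_cong) (auto simp: indicator_def)
  finally have "(\<integral>\<^sup>+y. ennreal (indicator (snd c ` W) y * vdens c y) \<partial>lborel) = 0"
    using * by simp
  moreover have "(\<lambda>y. indicator (snd c ` W) y * vdens c y) \<in> borel_measurable borel"
    using borel_measurable_continuous_on_indicator[OF _ continuous_on_subset[OF C1_on_imp_continuous_on[OF C1_vdens[OF c]]], of "snd c ` W"]
      op W(2) by (simp add: image_mono)
  ultimately have "AE y in lborel. ennreal (indicator (snd c ` W) y * vdens c y) = 0"
    by (subst (asm) nn_integral_0_iff_AE) auto
  then have "AE y in lborel. y \<notin> snd c ` W"
    by (rule AE_mp) (use vdens_pos[OF c] W(2) in \<open>force intro!: AE_I2 simp: indicator_def\<close>)
  then have "emeasure lborel (snd c ` W) = 0"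
    using op by (subst (asm) AE_iff_measurable[of "snd c ` W"]) auto
  then have "negligible (snd c ` W)"
    using op by (simp add: negligible_iff_null_sets null_sets_def)
  then show False using open_not_negligible[OF op] W(3) by auto
qed

text \<open>Chart independence of the divergence: integration by parts against bump functions in either
  chart yields the same weak divergence, so the transformation of second derivatives is not needed.\<close>

lemma divc_le:
  assumes c: "c \<in> A" "\<theta> \<in> fst c" and d: "d \<in> A" "\<theta> \<in> fst d"
  shows "divc c \<theta> \<le> divc d \<theta>"
proof (rule ccontr)
  assume less: "\<not> divc c \<theta> \<le> divc d \<theta>"
  let ?U = "fst c \<inter> fst d"
  have opU: "open ?U" using open_domain[OF c(1)] open_domain[OF d(1)] by (rule open_Int)
  have cont: "continuous_on ?U (\<lambda>x. divc c x - divc d x)"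
    using c d by (intro continuous_on_diff continuous_on_subset[OF continuous_on_divc]) auto
  \<comment> \<open>Both coordinate divergences are continuous, so a strict excess at
    \<open>\<theta>\<close> persists on a neighbourhood, where a bump function can be
    placed.\<close>
  define W where "W = ?U \<inter> (\<lambda>x. divc c x - divc d x) -` {0<..}"
  have W: "open W" unfolding W_def by (rule continuous_open_preimage[OF cont opU]) simp
  have \<theta>: "\<theta> \<in> W" using less c d by (auto simp: W_def)
  have Wc: "W \<subseteq> fst c" by (auto simp: W_def)
  obtain b K where b: "C1_function A b" "compact K" "K \<subseteq> W" "\<And>x. x \<notin> K \<Longrightarrow> b x = 0"
    "\<And>x. b x \<ge> 0" "b \<theta> > 0" using bump_exists[OF c(1) W Wc \<theta>] by metis
  have Kc: "K \<subseteq> fst c" and Kd: "K \<subseteq> fst d" using b(3) by (auto simp: W_def)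
  have ic: "integrable vol (\<lambda>x. D b x + b x * divc c x)" "(\<integral>x. D b x + b x * divc c x \<partial>vol) = 0"
    and id: "integrable vol (\<lambda>x. D b x + b x * divc d x)" "(\<integral>x. D b x + b x * divc d x \<partial>vol) = 0"
    using integration_by_parts_chart[OF c(1) b(1,2) Kc] integration_by_parts_chart[OF d(1) b(1,2) Kd] b(4)
    by blast+
  \<comment> \<open>Subtracting the two identities for the same test function cancels
    \<open>D b\<close>. What remains is nonnegative with integral zero, yet positive on the open set
    where \<open>b\<close> is positive.\<close>
  let ?f = "\<lambda>x. b x * (divc c x - divc d x)"
  have feq: "?f = (\<lambda>x. (D b x + b x * divc c x) - (D b x + b x * divc d x))"
    by (simp add: fun_eq_iff algebra_simps)
  have int: "integrable vol ?f" unfolding feq by (intro Bochner_Integration.integrable_diff ic id)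
  have zero: "(\<integral>x. ?f x \<partial>vol) = 0"
    unfolding feq by (subst Bochner_Integration.integral_diff[OF ic(1) id(1)]) (simp add: ic(2) id(2))
  have nn: "?f x \<ge> 0" for x
  proof (cases "x \<in> K")
    case True then show ?thesis using b(3,5) by (auto simp: W_def intro!: mult_nonneg_nonneg)
  qed (simp add: b(4))
  have ae: "AE x in vol. ?f x = 0"
    using integral_nonneg_eq_0_iff_AE[OF int] zero nn by simp
  define N where "N = {x. b x > 0}"
  have NW: "N \<subseteq> W" using b(3,4) unfolding N_def by (metis less_irrefl mem_Collect_eq subset_iff)
  have N: "open N" unfolding N_def
    by (intro open_Collect_less C1_function_imp_continuous_on b(1) continuous_intros)
  have "AE x in vol. x \<notin> N"
    using ae by (rule AE_mp) (use NW in \<open>auto intro!: AE_I2 simp: W_def N_def\<close>)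
  then have "emeasure vol N = 0"
    using N by (subst (asm) AE_iff_measurable[of N]) (auto simp: sets_vol space_vol)
  then show False
    using emeasure_vol_open_pos[OF c(1) N] NW Wc b(6) by (auto simp: N_def)
qed

lemma divergence_eq_chart:
  assumes "c \<in> A" "\<theta> \<in> fst c"
  shows "divergence A g V \<theta> = divc c \<theta>"
  unfolding divergence_eq_divc
  by (rule antisym) (rule divc_le; use assms chart_at_props in simp)+

lemma continuous_on_divergence: "continuous_on UNIV (divergence A g V)"
  by (rule continuous_on_charts, rule continuous_on_eq[OF continuous_on_divc])
    (auto simp: divergence_eq_chart)

text \<open>Regularity and integrability travel with the vanishing integral, so that the property is
  closed under sums: \<open>D\<close> is additive on C1 functions, the integral on integrable
  ones.\<close>

definition int_by_parts :: "('a \<Rightarrow> real) \<Rightarrow> bool"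
  where "int_by_parts f \<longleftrightarrow> C1_function A f
    \<and> integrable vol (\<lambda>\<theta>. D f \<theta> + f \<theta> * divergence A g V \<theta>)
    \<and> (\<integral>\<theta>. D f \<theta> + f \<theta> * divergence A g V \<theta> \<partial>vol) = 0"

lemma int_by_parts_chart:
  assumes c: "c \<in> A" and u: "C1_function A u" and K: "compact K" "K \<subseteq> fst c" "\<And>x. x \<notin> K \<Longrightarrow> u x = 0"
  shows "int_by_parts u"
proof -
  have *: "u \<theta> * divergence A g V \<theta> = u \<theta> * divc c \<theta>" for \<theta>
    using divergence_eq_chart[OF c] K by (cases "\<theta> \<in> K") auto
  show ?thesis
    using integration_by_parts_chart[OF assms] u unfolding int_by_parts_def * by simp
qed

lemma int_by_parts_add:
  assumes f: "int_by_parts f" and h: "int_by_parts h"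
  shows "int_by_parts (\<lambda>x. f x + h x)"
proof -
  have *: "D (\<lambda>x. f x + h x) \<theta> + (f \<theta> + h \<theta>) * divergence A g V \<theta>
    = (D f \<theta> + f \<theta> * divergence A g V \<theta>) + (D h \<theta> + h \<theta> * divergence A g V \<theta>)" for \<theta>
    using assms D_add unfolding int_by_parts_def by (simp add: algebra_simps)
  show ?thesis
    using assms C1_function_add[of f h] unfolding int_by_parts_def *
    by (simp add: Bochner_Integration.integral_add)
qed

lemma int_by_parts_sum:
  assumes "\<And>i. i \<in> I \<Longrightarrow> int_by_parts (f i)"
  shows "int_by_parts (\<lambda>x. \<Sum>i\<in>I. f i x)"
proof -
  have "int_by_parts (\<lambda>x. 0)"
    using D_eq_0_outside[OF C1_function_const, of "{}" 0] C1_function_const[of 0]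
    by (simp add: int_by_parts_def)
  then show ?thesis
    using assms by (induction I rule: infinite_finite_induct) (auto intro: int_by_parts_add)
qed

text \<open>A partition of unity over \<open>K\<close>: by compactness finitely many bump functions,
  each supported in one chart, have a sum \<open>B\<close> positive on \<open>K\<close>. Then
  \<open>u\<close> is the sum of the functions \<open>(u / B) * b \<theta>\<close>, to each of which
  the result for a single chart applies.\<close>

theorem integration_by_parts:
  assumes u: "C1_function A u" and K: "compact K" "\<And>x. x \<notin> K \<Longrightarrow> u x = 0"
  shows "integrable vol (\<lambda>\<theta>. D u \<theta> + u \<theta> * divergence A g V \<theta>)"
    and "(\<integral>\<theta>. D u \<theta> + u \<theta> * divergence A g V \<theta> \<partial>vol) = 0"
proof -
  have "\<forall>\<theta>. \<exists>b L. C1_function A b \<and> compact L \<and> L \<subseteq> fst (chart_at A \<theta>) \<and> (\<forall>x. x \<notin> L \<longrightarrow> b x = 0)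
      \<and> (\<forall>x. b x \<ge> 0) \<and> b \<theta> > 0"
  proof
    fix \<theta>
    show "\<exists>b L. C1_function A b \<and> compact L \<and> L \<subseteq> fst (chart_at A \<theta>) \<and> (\<forall>x. x \<notin> L \<longrightarrow> b x = 0)
      \<and> (\<forall>x. b x \<ge> 0) \<and> b \<theta> > 0"
      using bump_exists[OF chart_at_props(1) open_domain[OF chart_at_props(1)] order_refl chart_at_props(2)]
      by metis
  qed
  then obtain b L where "\<forall>\<theta>. C1_function A (b \<theta>) \<and> compact (L \<theta>) \<and> L \<theta> \<subseteq> fst (chart_at A \<theta>)
      \<and> (\<forall>x. x \<notin> L \<theta> \<longrightarrow> b \<theta> x = 0) \<and> (\<forall>x. b \<theta> x \<ge> 0) \<and> b \<theta> \<theta> > 0"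
    by metis
  then have b: "C1_function A (b \<theta>)" "compact (L \<theta>)" "L \<theta> \<subseteq> fst (chart_at A \<theta>)"
      "x \<notin> L \<theta> \<Longrightarrow> b \<theta> x = 0" "b \<theta> x \<ge> 0" "b \<theta> \<theta> > 0" for \<theta> x by auto
  have op: "open {x. b \<theta> x > 0}" for \<theta>
    by (intro open_Collect_less C1_function_imp_continuous_on b(1) continuous_intros)
  have cov: "K \<subseteq> (\<Union>\<theta>\<in>K. {x. b \<theta> x > 0})" using b(6) by auto
  obtain F where F: "F \<subseteq> K" "finite F" "K \<subseteq> (\<Union>\<theta>\<in>F. {x. b \<theta> x > 0})"
    using compactE_image[OF K(1), of K "\<lambda>\<theta>. {x. b \<theta> x > 0}"] op cov by metis
  define B where "B = (\<lambda>x. \<Sum>\<theta>\<in>F. b \<theta> x)"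
  have B1: "C1_function A B" unfolding B_def by (intro C1_function_sum b(1))
  have Bpos: "B x > 0" if x: "x \<in> K" for x
  proof -
    obtain \<theta> where "\<theta> \<in> F" "b \<theta> x > 0" using F(3) x by auto
    then show ?thesis unfolding B_def using b(5) F(2) by (intro sum_pos2[of F \<theta>]) auto
  qed
  \<comment> \<open>Off \<open>K\<close> the quotient vanishes because \<open>u\<close> does, even where \<open>B = 0\<close>.\<close>
  define v where "v = (\<lambda>x. u x / B x)"
  have BW: "open {x. B x > 0}"
    by (intro open_Collect_less C1_function_imp_continuous_on B1 continuous_intros)
  have "C1_in {x. B x > 0} (\<lambda>x. inverse (B x))"
    by (rule C1_in_compose_real[where T="{0<..}" and q=inverse and q'="\<lambda>t. - (inverse t * inverse t)"])
      (use B1 in \<open>auto simp: C1_in_UNIV[symmetric] power2_eq_square intro!: continuous_intros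
        derivative_eq_intros elim: C1_in_subset\<close>)
  then have "C1_in {x. B x > 0} v"
    unfolding v_def divide_inverse using u C1_in_subset[of UNIV u] by (intro C1_in_mult) (auto simp: C1_in_UNIV)
  moreover have "C1_in (- K) v"
    by (rule C1_in_cong[OF _ _ C1_in_const[of _ 0]]) (use K compact_imp_closed in \<open>auto simp: v_def\<close>)
  ultimately have "C1_in ({x. B x > 0} \<union> - K) v"
    using compact_imp_closed[OF K(1)] BW by (intro C1_in_Un) auto
  moreover have "{x. B x > 0} \<union> - K = UNIV" using Bpos by auto
  ultimately have v1: "C1_function A v" by (simp add: C1_in_UNIV)
  have "int_by_parts (\<lambda>x. \<Sum>\<theta>\<in>F. v x * b \<theta> x)"
  proof (rule int_by_parts_sum)
    show "int_by_parts (\<lambda>x. v x * b \<theta> x)" for \<theta>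
      by (rule int_by_parts_chart[OF chart_at_props(1) C1_function_mult[OF v1 b(1)] b(2,3)[of \<theta>]]) (simp add: b(4))
  qed
  moreover have "(\<lambda>x. \<Sum>\<theta>\<in>F. v x * b \<theta> x) = u"
  proof
    fix x
    have "(\<Sum>\<theta>\<in>F. v x * b \<theta> x) = v x * B x" by (simp add: B_def sum_distrib_left)
    also have "\<dots> = u x" using Bpos[of x] K(2)[of x] by (cases "x \<in> K") (auto simp: v_def)
    finally show "(\<Sum>\<theta>\<in>F. v x * b \<theta> x) = u x" .
  qed
  ultimately have "int_by_parts u" by simp
  then show "integrable vol (\<lambda>\<theta>. D u \<theta> + u \<theta> * divergence A g V \<theta>)"
    and "(\<integral>\<theta>. D u \<theta> + u \<theta> * divergence A g V \<theta> \<partial>vol) = 0"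
    by (auto simp: int_by_parts_def)
qed

subsection \<open>Localized Stein bound for the posterior\<close>

lemma matrix_inv_mult_metric:
  assumes "c \<in> A" "\<theta> \<in> fst c"
  shows "g c \<theta> *v (matrix_inv (g c \<theta>) *v v) = v"
proof -
  have "invertible (g c \<theta>)" using det_metric_pos[OF assms] by (simp add: invertible_det_nz)
  then have "g c \<theta> ** matrix_inv (g c \<theta>) = mat 1"
    unfolding invertible_def matrix_inv_def by (rule someI2_ex) simp
  then show ?thesis by (simp add: matrix_vector_mul_assoc)
qed

text \<open>The metric in the inner product cancels the inverse metric in the gradient, so only the
  directional derivative along \<open>V\<close> is left. With the gradient in the left slot the
  symmetry of \<open>g\<close> is used in addition.\<close>

lemma riem_inner_gradient_right: "riem_inner A g V (gradient g f) \<theta> = D f \<theta>"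
  by (simp add: riem_inner_def gradient_def D_def Let_def matrix_inv_mult_metric[OF chart_at_props])

lemma riem_inner_gradient_left: "riem_inner A g (gradient g f) V \<theta> = D f \<theta>"
proof -
  let ?c = "chart_at A \<theta>"
  let ?x = "matrix_inv (g ?c \<theta>) *v coord_deriv ?c f \<theta>"
  have sym: "transpose (g ?c \<theta>) = g ?c \<theta>"
    using metric chart_at_props by (simp add: riemannian_metric_def)
  have "?x \<bullet> (g ?c \<theta> *v V ?c \<theta>) = (?x v* g ?c \<theta>) \<bullet> V ?c \<theta>" by (rule dot_lmul_matrix[symmetric])
  also have "?x v* g ?c \<theta> = g ?c \<theta> *v ?x" using transpose_matrix_vector[of "g ?c \<theta>" ?x] sym by simp
  finally show ?thesis
    by (simp add: riem_inner_def gradient_def D_def Let_def matrix_inv_mult_metric[OF chart_at_props] inner_commute)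
qed

lemma weighted_divergence_eq:
  "weighted_divergence A g w V \<theta> = divergence A g V \<theta> + D (\<lambda>t. ln (w t)) \<theta>"
  by (simp add: weighted_divergence_def riem_inner_gradient_right)

text \<open>The divergence theorem for \<open>u * r\<close>, with \<open>r\<close> the density of
  \<open>Q\<close>. Since \<open>D r = r * D L\<close>, differentiating the weight adds
  \<open>D L\<close> to the divergence; when \<open>L\<close> is log-likelihood plus log prior
  density, this sum is the prior-weighted divergence plus the derivative of the
  log-likelihood.\<close>

lemma integration_by_parts_density:
  assumes L: "C1_function A L" and N: "N > 0"
    and Q: "Q = density vol (\<lambda>\<theta>. ennreal (exp (L \<theta>) / N))"
    and u: "C1_function A u" and K: "compact K" "\<And>x. x \<notin> K \<Longrightarrow> u x = 0"
  shows "(\<integral>\<theta>. D u \<theta> + u \<theta> * (divergence A g V \<theta> + D L \<theta>) \<partial>Q) = 0"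
proof -
  let ?q = "\<lambda>t. exp t / N"
  have q: "(?q has_real_derivative ?q t) (at t)" for t
    using N by (auto intro!: derivative_eq_intros)
  have qc: "continuous_on UNIV ?q" using N by (intro continuous_intros) auto
  define r where "r = (\<lambda>\<theta>. ?q (L \<theta>))"
  have r: "C1_function A r" unfolding r_def by (rule C1_function_compose_real[OF L q qc]) simp
  have Dr: "D r \<theta> = r \<theta> * D L \<theta>" for \<theta> unfolding r_def by (rule D_compose_real[OF L q qc]) simp
  have rc: "r \<in> borel_measurable vol"
    using borel_measurable_continuous_onI[OF C1_function_imp_continuous_on[OF r]]
    by (simp cong: measurable_cong_sets add: sets_vol)
  have "continuous_on UNIV (\<lambda>\<theta>. D u \<theta> + u \<theta> * (divergence A g V \<theta> + D L \<theta>))"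
    by (intro continuous_intros continuous_on_D continuous_on_divergence C1_function_imp_continuous_on u L)
  from borel_measurable_continuous_onI[OF this]
  have m: "(\<lambda>\<theta>. D u \<theta> + u \<theta> * (divergence A g V \<theta> + D L \<theta>)) \<in> borel_measurable vol"
    by (simp cong: measurable_cong_sets add: sets_vol)
  have "(\<integral>\<theta>. D u \<theta> + u \<theta> * (divergence A g V \<theta> + D L \<theta>) \<partial>Q)
      = (\<integral>\<theta>. r \<theta> * (D u \<theta> + u \<theta> * (divergence A g V \<theta> + D L \<theta>)) \<partial>vol)"
    unfolding Q using integral_density[OF m rc] N by (simp add: r_def)
  also have "\<dots> = (\<integral>\<theta>. D (\<lambda>x. u x * r x) \<theta> + (u \<theta> * r \<theta>) * divergence A g V \<theta> \<partial>vol)"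
    by (intro Bochner_Integration.integral_cong refl, unfold D_mult[OF u r] Dr) (simp add: algebra_simps)
  also have "\<dots> = 0"
    by (rule integration_by_parts(2)[OF C1_function_mult[OF u r] K(1)]) (simp add: K(2))
  finally show ?thesis .
qed

text \<open>The estimate for one test function, with a right side that does not involve
  \<open>h\<close> and thus survives the supremum. Here \<open>a\<close> stands for the square root
  of the sample size and \<open>L\<close> for the logarithm of the unnormalised posterior density
  with respect to the volume.\<close>

lemma stein_bound:
  fixes h :: "real \<Rightarrow> real" and \<Phi> chi :: "'a \<Rightarrow> real"
  assumes L: "C1_function A L" and N: "N > 0"
    and Q: "Q = density vol (\<lambda>\<theta>. ennreal (exp (L \<theta>) / N))" "prob_space Q"
    and Phi: "C1_function A \<Phi>" and chi: "C1_function A chi" "\<And>\<theta>. chi \<theta> \<in> {0..1}"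
    and K: "compact K" "\<And>\<theta>. \<theta> \<notin> K \<Longrightarrow> chi \<theta> = 0"
    and mpos: "(\<integral>\<theta>. chi \<theta> \<partial>Q) > 0" and a: "a > 0" and s: "s > 0"
    and hb: "\<And>x. \<bar>h x\<bar> \<le> 1" and hc: "continuous_on UNIV h"
  shows "\<bar>(\<integral>\<theta>. h (a * (\<Phi> \<theta> - \<psi>)) \<partial>Q) - (\<integral>x. h x \<partial>density lborel (\<lambda>z. ennreal (normal_density 0 s z)))\<bar>
    \<le> (sqrt (2 * pi) / s * a * (\<integral>\<theta>. chi \<theta> * \<bar>\<Phi> \<theta> - \<psi> + (divergence A g V \<theta> + D L \<theta>) / a\<^sup>2\<bar> \<partial>Q)
      + 4 / s\<^sup>2 * (\<integral>\<theta>. chi \<theta> * \<bar>s\<^sup>2 - D \<Phi> \<theta>\<bar> \<partial>Q)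
      + sqrt (2 * pi) / s / a * (\<integral>\<theta>. \<bar>D chi \<theta>\<bar> \<partial>Q)) / (\<integral>\<theta>. chi \<theta> \<partial>Q)
      + 2 * (\<integral>\<theta>. 1 - chi \<theta> \<partial>Q)"
proof -
  interpret Q: prob_space Q by (rule Q)
  have sets_Q: "sets Q = sets borel" by (simp add: Q sets_vol)
  have meas: "F \<in> borel_measurable Q" if "continuous_on UNIV F" for F :: "'a \<Rightarrow> real"
    using borel_measurable_continuous_onI[OF that] by (simp cong: measurable_cong_sets add: sets_Q)
  have intb: "integrable Q F" if "continuous_on UNIV F" "\<And>x. \<bar>F x\<bar> \<le> 1" for F :: "'a \<Rightarrow> real"
    by (rule Q.integrable_const_bound[of _ 1]) (use that meas in auto)
  \<comment> \<open>Continuity and vanishing off a compact set give boundedness, and bounded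
    measurable functions are integrable for a probability measure. The divergence and the derivative
    along \<open>V\<close> may be unbounded on the whole manifold; multiplication by
    \<open>chi\<close>, or the vanishing of \<open>D chi\<close> off \<open>K\<close>, tames
    them.\<close>
  have intK: "integrable Q F" if F: "continuous_on UNIV F" "\<And>x. x \<notin> K \<Longrightarrow> F x = 0" for F :: "'a \<Rightarrow> real"
  proof -
    have "bounded (F ` K)"
      by (intro compact_imp_bounded compact_continuous_image K continuous_on_subset[OF F(1)]) auto
    then obtain M where M: "\<And>x. x \<in> K \<Longrightarrow> \<bar>F x\<bar> \<le> M" unfolding bounded_iff by auto
    have "\<bar>F x\<bar> \<le> \<bar>M\<bar>" for x using M[of x] F(2)[of x] by (cases "x \<in> K") auto
    then show ?thesis by (intro Q.integrable_const_bound[of _ "\<bar>M\<bar>"] meas F) auto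
  qed
  define Nh where "Nh = (\<integral>x. h x \<partial>density lborel (\<lambda>z. ennreal (normal_density 0 s z)))"
  obtain f f' where f: "\<And>x. (f has_real_derivative f' x) (at x)" "continuous_on UNIV f'"
    "\<And>x. \<bar>f x\<bar> \<le> sqrt (2 * pi) / s" "\<And>x. \<bar>f' x\<bar> \<le> 4 / s\<^sup>2"
    "\<And>x. s\<^sup>2 * f' x - x * f x = h x - Nh"
    using stein_equation_solution[OF s hb hc] unfolding Nh_def by metis
  define Z where "Z = (\<lambda>\<theta>. a * (\<Phi> \<theta> - \<psi>))"
  have az: "((\<lambda>t. a * (t - \<psi>)) has_real_derivative a) (at t)" for t by (auto intro!: derivative_eq_intros)
  have Z: "C1_function A Z" unfolding Z_def
    by (rule C1_function_compose_real[OF Phi az]) (auto intro: continuous_on_const)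
  have DZ: "D Z \<theta> = a * D \<Phi> \<theta>" for \<theta>
    unfolding Z_def by (rule D_compose_real[OF Phi az]) (auto intro: continuous_on_const)
  have fZ: "C1_function A (\<lambda>\<theta>. f (Z \<theta>))" by (rule C1_function_compose_real[OF Z f(1,2)]) simp
  have DfZ: "D (\<lambda>\<theta>. f (Z \<theta>)) \<theta> = f' (Z \<theta>) * (a * D \<Phi> \<theta>)" for \<theta>
    using D_compose_real[OF Z f(1,2)] DZ by simp
  have cfZ: "continuous_on UNIV (\<lambda>\<theta>. f (Z \<theta>))" by (rule C1_function_imp_continuous_on[OF fZ])
  have cZ: "continuous_on UNIV Z" by (rule C1_function_imp_continuous_on[OF Z])
  have cf'Z: "continuous_on UNIV (\<lambda>\<theta>. f' (Z \<theta>))"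
    by (rule continuous_on_compose2[OF f(2) cZ]) simp
  have chZ: "continuous_on UNIV (\<lambda>\<theta>. h (Z \<theta>))"
    by (rule continuous_on_compose2[OF hc cZ]) simp
  have cchi: "continuous_on UNIV chi" by (rule C1_function_imp_continuous_on[OF chi(1)])
  have Dchi0: "D chi \<theta> = 0" if "\<theta> \<notin> K" for \<theta>
    by (rule D_eq_0_outside[OF chi(1) compact_imp_closed[OF K(1)] K(2) that])
  have chi01: "0 \<le> chi \<theta>" "chi \<theta> \<le> 1" for \<theta> using chi(2)[of \<theta>] by auto
  define S where "S = (\<lambda>\<theta>. divergence A g V \<theta> + D L \<theta>)"
  have cS: "continuous_on UNIV S"
    unfolding S_def by (intro continuous_intros continuous_on_D continuous_on_divergence L)
  define T where "T = (\<lambda>\<theta>. \<Phi> \<theta> - \<psi> + S \<theta> / a\<^sup>2)"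
  have cT: "continuous_on UNIV T"
    unfolding T_def using a by (intro continuous_intros cS C1_function_imp_continuous_on Phi) auto
  note cont = continuous_on_add continuous_on_diff continuous_on_mult continuous_on_rabs continuous_on_const
    cS cT cZ cfZ cf'Z chZ cchi continuous_on_D chi(1) Phi
  \<comment> \<open>The integrand of the weighted divergence theorem for the test function
    \<open>chi * f(Z)\<close>; its integral is zero.\<close>
  define I0 where "I0 = (\<lambda>\<theta>. D (\<lambda>x. chi x * f (Z x)) \<theta> + chi \<theta> * f (Z \<theta>) * S \<theta>)"
  have I0_eq: "I0 \<theta> = chi \<theta> * (f' (Z \<theta>) * (a * D \<Phi> \<theta>)) + f (Z \<theta>) * D chi \<theta> + chi \<theta> * f (Z \<theta>) * S \<theta>" for \<theta>
    unfolding I0_def by (simp add: D_mult[OF chi(1) fZ] DfZ)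
  have I0_int: "(\<integral>\<theta>. I0 \<theta> \<partial>Q) = 0"
    unfolding I0_def S_def
    by (rule integration_by_parts_density[OF L N Q(1) C1_function_mult[OF chi(1) fZ] K(1)]) (simp add: K(2))
  have I0_integrable: "integrable Q I0"
    unfolding I0_eq[abs_def] by (rule intK; (intro cont)?) (simp add: K(2) Dchi0)
  \<comment> \<open>Chosen so that \<open>R + I0 / a\<close> is \<open>chi\<close> times Stein's
    expression at \<open>Z\<close>. The \<open>S / a\<close> hidden in
    \<open>a * T = Z + S / a\<close> cancels against the divergence part of \<open>I0 / a\<close>,
    the \<open>D \<Phi>\<close> term against the derivative of \<open>f(Z)\<close>, and the
    \<open>D chi\<close> term against its counterpart.\<close>
  define R where "R = (\<lambda>\<theta>. chi \<theta> * (f' (Z \<theta>) * (s\<^sup>2 - D \<Phi> \<theta>)) - a * (chi \<theta> * (f (Z \<theta>) * T \<theta>)) - (1 / a) * (f (Z \<theta>) * D chi \<theta>))"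
  have R_integrable: "integrable Q R"
    unfolding R_def by (rule intK; (intro cont)?) (simp add: K(2) Dchi0)
  have stein: "chi \<theta> * (h (Z \<theta>) - Nh) = R \<theta> + (1 / a) * I0 \<theta>" for \<theta>
  proof -
    have "a * T \<theta> = Z \<theta> + S \<theta> / a" using a by (simp add: T_def Z_def power2_eq_square field_simps)
    then have "a * (chi \<theta> * (f (Z \<theta>) * T \<theta>)) = chi \<theta> * f (Z \<theta>) * Z \<theta> + chi \<theta> * f (Z \<theta>) * (S \<theta> / a)"
      by (metis (no_types, opaque_lifting) distrib_left mult.assoc mult.left_commute)
    then have "R \<theta> + (1 / a) * I0 \<theta> = chi \<theta> * (s\<^sup>2 * f' (Z \<theta>) - Z \<theta> * f (Z \<theta>))"
      unfolding R_def I0_eq using a by (simp add: field_simps)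
    then show ?thesis using f(5) by simp
  qed
  let ?E = "\<lambda>F. \<integral>\<theta>. F \<theta> \<partial>Q"
  define m where "m = ?E chi"
  let ?c = "sqrt (2 * pi) / s"
  \<comment> \<open>A termwise majorant of \<open>\<bar>R\<bar>\<close>: \<open>f\<close> and
    \<open>f'\<close> are replaced by their uniform bounds, which removes all dependence on
    \<open>h\<close>.\<close>
  let ?U = "\<lambda>\<theta>. ?c * a * (chi \<theta> * \<bar>T \<theta>\<bar>) + 4 / s\<^sup>2 * (chi \<theta> * \<bar>s\<^sup>2 - D \<Phi> \<theta>\<bar>) + ?c / a * \<bar>D chi \<theta>\<bar>"
  have i1: "integrable Q (\<lambda>\<theta>. chi \<theta> * \<bar>T \<theta>\<bar>)"
    and i2: "integrable Q (\<lambda>\<theta>. chi \<theta> * \<bar>s\<^sup>2 - D \<Phi> \<theta>\<bar>)"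
    and i3: "integrable Q (\<lambda>\<theta>. \<bar>D chi \<theta>\<bar>)"
    by (rule intK; (intro cont)?; simp add: K(2) Dchi0)+
  have "?E (\<lambda>\<theta>. chi \<theta> * (h (Z \<theta>) - Nh)) = ?E R"
    unfolding stein using I0_int I0_integrable R_integrable by simp
  also have "\<bar>\<dots>\<bar> \<le> ?E (\<lambda>\<theta>. \<bar>R \<theta>\<bar>)" by (rule integral_abs_bound)
  also have "\<dots> \<le> ?E ?U"
  proof (rule integral_mono)
    show "integrable Q ?U"
      by (intro Bochner_Integration.integrable_add integrable_mult_right i1 i2 i3)
    show "\<bar>R \<theta>\<bar> \<le> ?U \<theta>" for \<theta>
    proof -
      have 1: "\<bar>chi \<theta> * (f' (Z \<theta>) * (s\<^sup>2 - D \<Phi> \<theta>))\<bar> \<le> 4 / s\<^sup>2 * (chi \<theta> * \<bar>s\<^sup>2 - D \<Phi> \<theta>\<bar>)"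
        using mult_right_mono[OF f(4)[of "Z \<theta>"], of "chi \<theta> * \<bar>s\<^sup>2 - D \<Phi> \<theta>\<bar>"] chi01[of \<theta>]
        by (simp add: abs_mult mult_ac)
      have 2: "\<bar>a * (chi \<theta> * (f (Z \<theta>) * T \<theta>))\<bar> \<le> ?c * a * (chi \<theta> * \<bar>T \<theta>\<bar>)"
        using mult_right_mono[OF f(3)[of "Z \<theta>"], of "a * (chi \<theta> * \<bar>T \<theta>\<bar>)"] chi01[of \<theta>] a
        by (simp add: abs_mult mult_ac)
      have 3: "\<bar>(1 / a) * (f (Z \<theta>) * D chi \<theta>)\<bar> \<le> ?c / a * \<bar>D chi \<theta>\<bar>"
        using mult_right_mono[OF f(3)[of "Z \<theta>"], of "(1 / a) * \<bar>D chi \<theta>\<bar>"] a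
        by (simp add: abs_mult mult_ac)
      show ?thesis unfolding R_def using 1 2 3 by linarith
    qed
  qed (use R_integrable in simp)
  also have "?E ?U = ?c * a * ?E (\<lambda>\<theta>. chi \<theta> * \<bar>T \<theta>\<bar>) + 4 / s\<^sup>2 * ?E (\<lambda>\<theta>. chi \<theta> * \<bar>s\<^sup>2 - D \<Phi> \<theta>\<bar>)
      + ?c / a * ?E (\<lambda>\<theta>. \<bar>D chi \<theta>\<bar>)" (is "_ = ?W")
    by (subst Bochner_Integration.integral_add, intro Bochner_Integration.integrable_add integrable_mult_right i1 i2,
        intro integrable_mult_right i3, subst Bochner_Integration.integral_add,
        intro integrable_mult_right i1, intro integrable_mult_right i2) simp
  finally have W: "\<bar>?E (\<lambda>\<theta>. chi \<theta> * (h (Z \<theta>) - Nh))\<bar> \<le> ?W" .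
  have ichi: "integrable Q chi" by (rule intb[OF cchi]) (use chi01 in auto)
  have ihZ: "integrable Q (\<lambda>\<theta>. h (Z \<theta>))" by (rule intb[OF chZ hb])
  have ichih: "integrable Q (\<lambda>\<theta>. chi \<theta> * h (Z \<theta>))"
    by (rule intK; (intro cont)?) (simp add: K(2))
  have E1: "?E (\<lambda>\<theta>. chi \<theta> * (h (Z \<theta>) - Nh)) = ?E (\<lambda>\<theta>. chi \<theta> * h (Z \<theta>)) - m * Nh"
    unfolding m_def using ichi ichih by (simp add: right_diff_distrib)
  have E2: "?E (\<lambda>\<theta>. 1 - chi \<theta>) = 1 - m"
    unfolding m_def using ichi by (simp add: Q.prob_space)
  have E3: "\<bar>?E (\<lambda>\<theta>. chi \<theta> * h (Z \<theta>))\<bar> \<le> m"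
  proof -
    have "\<bar>?E (\<lambda>\<theta>. chi \<theta> * h (Z \<theta>))\<bar> \<le> ?E (\<lambda>\<theta>. \<bar>chi \<theta> * h (Z \<theta>)\<bar>)" by (rule integral_abs_bound)
    also have "\<dots> \<le> m" unfolding m_def
      using mult_left_mono[OF hb chi01(1)] chi01
      by (intro integral_mono integrable_abs ichih ichi) (simp add: abs_mult)
    finally show ?thesis .
  qed
  have E4: "\<bar>?E (\<lambda>\<theta>. h (Z \<theta>)) - ?E (\<lambda>\<theta>. chi \<theta> * h (Z \<theta>))\<bar> \<le> 1 - m"
  proof -
    have "?E (\<lambda>\<theta>. h (Z \<theta>)) - ?E (\<lambda>\<theta>. chi \<theta> * h (Z \<theta>)) = ?E (\<lambda>\<theta>. (1 - chi \<theta>) * h (Z \<theta>))"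
      using ihZ ichih by (simp add: left_diff_distrib)
    also have "\<bar>\<dots>\<bar> \<le> ?E (\<lambda>\<theta>. \<bar>(1 - chi \<theta>) * h (Z \<theta>)\<bar>)" by (rule integral_abs_bound)
    also have "\<dots> \<le> ?E (\<lambda>\<theta>. 1 - chi \<theta>)"
    proof (rule integral_mono)
      show "integrable Q (\<lambda>\<theta>. \<bar>(1 - chi \<theta>) * h (Z \<theta>)\<bar>)"
        using ihZ ichih by (intro integrable_abs) (simp add: left_diff_distrib)
      show "\<bar>(1 - chi \<theta>) * h (Z \<theta>)\<bar> \<le> 1 - chi \<theta>" for \<theta>
        using mult_left_mono[OF hb[of "Z \<theta>"], of "1 - chi \<theta>"] chi01[of \<theta>] by (simp add: abs_mult)
    qed (use ichi in simp)
    finally show ?thesis by (simp only: E2)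
  qed
  have m: "0 < m" using mpos by (simp add: m_def)
  define x where "x = ?E (\<lambda>\<theta>. chi \<theta> * h (Z \<theta>))"
  have "\<bar>x - x / m\<bar> \<le> 1 - m"
  proof -
    \<comment> \<open>\<open>E4\<close> bounds an absolute value by \<open>1 - m\<close>, which is
      therefore nonnegative.\<close>
    have m1: "m \<le> 1" using E4 by linarith
    have "\<bar>x - x / m\<bar> = \<bar>x\<bar> * ((1 - m) / m)"
    proof -
      have "x - x / m = - (x * ((1 - m) / m))" using m by (simp add: field_simps)
      then show ?thesis using m m1 by (simp add: abs_mult)
    qed
    also have "\<dots> \<le> m * ((1 - m) / m)"
      using E3 m m1 by (intro mult_right_mono) (auto simp: x_def)
    finally show ?thesis using m by simp
  qed
  moreover have "\<bar>x / m - Nh\<bar> \<le> ?W / m"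
  proof -
    have "\<bar>x - m * Nh\<bar> / m \<le> ?W / m" using W m unfolding E1 x_def by (intro divide_right_mono) auto
    moreover have "\<bar>x / m - Nh\<bar> = \<bar>x - m * Nh\<bar> / m"
    proof -
      have "x / m - Nh = (x - m * Nh) / m" using m by (simp add: field_simps)
      then show ?thesis using m by simp
    qed
    ultimately show ?thesis by simp
  qed
  ultimately have "\<bar>?E (\<lambda>\<theta>. h (Z \<theta>)) - Nh\<bar> \<le> ?W / m + 2 * (1 - m)"
  proof -
    \<comment> \<open>The chain runs from the expectation \<open>p\<close> under \<open>Q\<close>
      through the unnormalised localized value \<open>x\<close> and the normalised value
      \<open>y\<close> to the normal expectation \<open>q\<close>. The first two links cost
      \<open>1 - m\<close> each.\<close>
    have "\<bar>p - q\<bar> \<le> e + 2 * d" if "\<bar>x - y\<bar> \<le> d" "\<bar>y - q\<bar> \<le> e" "\<bar>p - x\<bar> \<le> d" for p q x y d e :: real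
      using that by linarith
    from this[of x "x / m" "1 - m" Nh "?W / m"] show ?thesis
      if "\<bar>x - x / m\<bar> \<le> 1 - m" "\<bar>x / m - Nh\<bar> \<le> ?W / m" using that E4 unfolding x_def .
  qed
  then show ?thesis unfolding E2[symmetric] unfolding m_def Nh_def T_def S_def Z_def by simp
qed

end

section \<open>The bound for the posterior of the statistical model\<close>

theorem lemma1:
  fixes A :: "('a::{t2_space, second_countable_topology}, 'p::finite) chart set"
    and lam :: "'x measure" and P :: "'a \<Rightarrow> 'x measure" and l :: "'a \<Rightarrow> 'x \<Rightarrow> real"
    and g :: "('a, 'p) metric_components" and vol :: "'a measure"
    and w :: "'a \<Rightarrow> real" and Prior Post :: "'a measure"
    and n :: nat and X :: "nat \<Rightarrow> 'x" and l_n :: "'a \<Rightarrow> real"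
    and \<sigma> :: real and \<Phi> \<Phi>_hat Z chi :: "'a \<Rightarrow> real"
    and V :: "('a, 'p) field_components" and \<Psi>0_hat :: "(nat \<Rightarrow> 'x) \<Rightarrow> real"
  assumes manifold: "smooth_atlas A"
    and model_prob: "\<And>\<theta>. prob_space (P \<theta>)"
    and loglik_meas: "\<And>\<theta>. l \<theta> \<in> borel_measurable lam"
    and model_density: "\<And>\<theta>. P \<theta> = density lam (\<lambda>x. ennreal (exp (l \<theta> x)))"
    and loglik_C1: "\<And>x. x \<in> space lam \<Longrightarrow> C1_function A (\<lambda>\<theta>. l \<theta> x)"
    and fisher_wd: "fisher_integrable A P l"
    and g_def: "g = fisher_metric P l"
    and fisher_riem: "riemannian_metric A g"
    and vol: "riemannian_volume A g vol"
    and prior_pos: "\<And>\<theta>. w \<theta> > 0"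
    and prior_C1: "C1_function A w"
    and Prior_def: "Prior = density vol (\<lambda>\<theta>. ennreal (w \<theta>))"
    and n: "n \<ge> 1"
    and data: "X \<in> space (PiM {1..n} (\<lambda>_. lam))"
    and l_n_def: "l_n = log_likelihood n l X"
    and lik_integrable: "integrable Prior (\<lambda>\<theta>. exp (l_n \<theta>))"
    and Post_def: "Post = posterior Prior l_n"
    and sigma_pos: "\<sigma> > 0"
    and Phi_C1: "C1_function A \<Phi>"
    and V_C1: "C1_vector_field A V"
    and chi_range: "\<And>\<theta>. chi \<theta> \<in> {0..1}"
    and chi_C1: "C1_function A chi"
    and chi_compact_support: "compact (closure {\<theta>. chi \<theta> \<noteq> 0})"
    and estimator: "\<Psi>0_hat \<in> borel_measurable (PiM {1..n} (\<lambda>_. lam))"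
    and Z_def: "Z = (\<lambda>\<theta>. sqrt (real n) * (\<Phi> \<theta> - \<Psi>0_hat X))"
    and Phi_hat_def:
      "\<Phi>_hat = (\<lambda>\<theta>. \<Phi> \<theta> + (1 / real n) * riem_inner A g V (gradient g l_n) \<theta>)"
    and chi_mass: "(\<integral>\<theta>. chi \<theta> \<partial>Post) > 0"
  shows "d_BL (distr Post borel Z) (density lborel (\<lambda>z. ennreal (normal_density 0 \<sigma> z)))
    \<le> (1 / \<sigma>) * sqrt (2 * real n * pi) *
        localized_expectation Post chi
          (\<lambda>\<theta>. \<bar>\<Phi>_hat \<theta> - \<Psi>0_hat X + (1 / real n) * weighted_divergence A g w V \<theta>\<bar>)
      + (4 / \<sigma>\<^sup>2) *
        localized_expectation Post chi (\<lambda>\<theta>. \<bar>\<sigma>\<^sup>2 - riem_inner A g (gradient g \<Phi>) V \<theta>\<bar>)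
      + (1 / \<sigma>) * sqrt (2 * pi / real n) *
        ((\<integral>\<theta>. \<bar>riem_inner A g (gradient g chi) V \<theta>\<bar> \<partial>Post) / (\<integral>\<theta>. chi \<theta> \<partial>Post))
      + 2 * (\<integral>\<theta>. 1 - chi \<theta> \<partial>Post)"
proof -
  interpret riemannian_vector_field A g vol V
    by unfold_locales (fact manifold fisher_riem vol V_C1)+
  have X: "X i \<in> space lam" if "i \<in> {1..n}" for i
    using data that by (auto simp: space_PiM PiE_def Pi_def)
  have l_n: "C1_function A l_n"
    unfolding l_n_def log_likelihood_def[abs_def] by (intro C1_function_sum loglik_C1 X)
  have lnw: "C1_function A (\<lambda>\<theta>. ln (w \<theta>))"
    by (rule C1_function_compose_real[OF prior_C1, of "{0<..}" ln inverse])
      (use prior_pos in \<open>auto intro!: continuous_intros DERIV_ln\<close>)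
  \<comment> \<open>Taking the density with respect to the volume rather than the prior puts the
    prior into the exponent, so a single derivative \<open>D L\<close> yields both the score term of
    \<open>\<Phi>_hat\<close> and the prior term of the weighted divergence.\<close>
  define L where "L = (\<lambda>\<theta>. l_n \<theta> + ln (w \<theta>))"
  have L: "C1_function A L" unfolding L_def by (rule C1_function_add[OF l_n lnw])
  have DL: "D L \<theta> = D l_n \<theta> + D (\<lambda>\<theta>. ln (w \<theta>)) \<theta>" for \<theta>
    unfolding L_def by (rule D_add[OF l_n lnw])
  have meas: "f \<in> borel_measurable vol" if "C1_function A f" for f :: "'a \<Rightarrow> real"
    using borel_measurable_continuous_onI[OF C1_function_imp_continuous_on[OF that]]
    by (simp cong: measurable_cong_sets add: sets_vol)
  note [measurable] = meas[OF l_n] meas[OF prior_C1] meas[OF chi_C1] meas[OF Phi_C1]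
  define N where "N = (\<integral>t. exp (l_n t) \<partial>Prior)"
  have Post: "Post = density Prior (\<lambda>\<theta>. ennreal (exp (l_n \<theta>) / N))"
    by (simp add: Post_def posterior_def N_def)
  have sets_Prior[measurable_cong]: "sets Prior = sets vol" by (simp add: Prior_def)
  \<comment> \<open>Division by zero gives zero, so a vanishing normaliser would make
    \<open>Post\<close> the null measure, against the positive mass of \<open>chi\<close>.\<close>
  have "N \<noteq> 0"
  proof
    assume "N = 0"
    then have "(\<integral>\<theta>. chi \<theta> \<partial>Post) = (\<integral>\<theta>. 0 *\<^sub>R chi \<theta> \<partial>Prior)"
      unfolding Post by (subst integral_density[symmetric]) auto
    then show False using chi_mass by simp
  qed
  moreover have "N \<ge> 0" by (simp add: N_def)
  ultimately have N: "N > 0" by simp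
  have Q: "Post = density vol (\<lambda>\<theta>. ennreal (exp (L \<theta>) / N))"
  proof -
    have "Post = density vol (\<lambda>\<theta>. ennreal (w \<theta>) * ennreal (exp (l_n \<theta>) / N))"
      unfolding Post Prior_def by (subst density_density_eq) auto
    moreover have "ennreal (w \<theta>) * ennreal (exp (l_n \<theta>) / N) = ennreal (exp (L \<theta>) / N)" for \<theta>
      using prior_pos[of \<theta>] N by (simp add: ennreal_mult'[symmetric] L_def exp_add mult.commute)
    ultimately show ?thesis by simp
  qed
  have prob: "prob_space Post"
  proof (rule prob_spaceI)
    have "emeasure Post (space Post) = (\<integral>\<^sup>+\<theta>. ennreal (exp (l_n \<theta>) / N) \<partial>Prior)"
      unfolding Post by (subst emeasure_density) (auto intro!: nn_integral_cong)
    also have "\<dots> = ennreal (\<integral>\<theta>. exp (l_n \<theta>) / N \<partial>Prior)"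
      using N by (intro nn_integral_eq_integral integrable_divide lik_integrable) auto
    also have "(\<integral>\<theta>. exp (l_n \<theta>) / N \<partial>Prior) = 1" using N by (simp add: N_def)
    finally show "emeasure Post (space Post) = 1" by simp
  qed
  let ?\<psi> = "\<Psi>0_hat X" and ?a = "sqrt (real n)"
  let ?m = "\<integral>\<theta>. chi \<theta> \<partial>Post"
  have a: "?a > 0" using n by simp
  \<comment> \<open>With \<open>?a\<^sup>2 = n\<close>, the log-likelihood part of
    \<open>D L\<close> divided by \<open>n\<close> is the correction that turns
    \<open>\<Phi>\<close> into \<open>\<Phi>_hat\<close>; the prior part completes the weighted
    divergence.\<close>
  have T: "\<Phi> \<theta> - ?\<psi> + (divergence A g V \<theta> + D L \<theta>) / ?a\<^sup>2
    = \<Phi>_hat \<theta> - ?\<psi> + (1 / real n) * weighted_divergence A g w V \<theta>" for \<theta>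
    by (simp add: DL Phi_hat_def weighted_divergence_eq riem_inner_gradient_right add_divide_distrib)
  have Zm: "Z \<in> borel_measurable Post"
    unfolding Z_def Q by measurable
  let ?B = "(1 / \<sigma>) * sqrt (2 * real n * pi) *
        localized_expectation Post chi
          (\<lambda>\<theta>. \<bar>\<Phi>_hat \<theta> - \<Psi>0_hat X + (1 / real n) * weighted_divergence A g w V \<theta>\<bar>)
      + (4 / \<sigma>\<^sup>2) *
        localized_expectation Post chi (\<lambda>\<theta>. \<bar>\<sigma>\<^sup>2 - riem_inner A g (gradient g \<Phi>) V \<theta>\<bar>)
      + (1 / \<sigma>) * sqrt (2 * pi / real n) *
        ((\<integral>\<theta>. \<bar>riem_inner A g (gradient g chi) V \<theta>\<bar> \<partial>Post) / ?m)
      + 2 * (\<integral>\<theta>. 1 - chi \<theta> \<partial>Post)"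
  show ?thesis
    unfolding d_BL_def
  proof (rule cSUP_least)
    show "{h :: real \<Rightarrow> real. (\<forall>x. h x \<in> {-1..1}) \<and> (\<forall>x y. \<bar>h x - h y\<bar> \<le> \<bar>x - y\<bar>)} \<noteq> {}"
      by (auto intro!: exI[of _ "\<lambda>_. 0"])
    fix h :: "real \<Rightarrow> real"
    assume "h \<in> {h. (\<forall>x. h x \<in> {-1..1}) \<and> (\<forall>x y. \<bar>h x - h y\<bar> \<le> \<bar>x - y\<bar>)}"
    then have hb: "\<bar>h x\<bar> \<le> 1" and lip: "\<bar>h x - h y\<bar> \<le> \<bar>x - y\<bar>" for x y
      by (auto simp: abs_le_iff minus_le_iff)
    have "1-lipschitz_on UNIV h" using lip by (intro lipschitz_onI) (auto simp: dist_real_def)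
    then have hc: "continuous_on UNIV h" by (rule lipschitz_on_continuous_on)
    have hm: "h \<in> borel_measurable borel" by (rule borel_measurable_continuous_onI[OF hc])
    have "\<bar>(\<integral>\<theta>. h (?a * (\<Phi> \<theta> - ?\<psi>)) \<partial>Post) - (\<integral>x. h x \<partial>density lborel (\<lambda>z. ennreal (normal_density 0 \<sigma> z)))\<bar>
      \<le> (sqrt (2 * pi) / \<sigma> * ?a * (\<integral>\<theta>. chi \<theta> * \<bar>\<Phi> \<theta> - ?\<psi> + (divergence A g V \<theta> + D L \<theta>) / ?a\<^sup>2\<bar> \<partial>Post)
      + 4 / \<sigma>\<^sup>2 * (\<integral>\<theta>. chi \<theta> * \<bar>\<sigma>\<^sup>2 - D \<Phi> \<theta>\<bar> \<partial>Post)
      + sqrt (2 * pi) / \<sigma> / ?a * (\<integral>\<theta>. \<bar>D chi \<theta>\<bar> \<partial>Post)) / ?m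
      + 2 * (\<integral>\<theta>. 1 - chi \<theta> \<partial>Post)"
    proof (rule stein_bound[OF L N Q prob Phi_C1 chi_C1 chi_range chi_compact_support _ chi_mass a sigma_pos hb hc])
      show "chi \<theta> = 0" if "\<theta> \<notin> closure {\<theta>. chi \<theta> \<noteq> 0}" for \<theta>
        using that closure_subset[of "{\<theta>. chi \<theta> \<noteq> 0}"] by auto
    qed
    \<comment> \<open>The factors \<open>?a\<close> and \<open>1 / ?a\<close> merge with
      \<open>sqrt (2 * pi)\<close> under one root, and the common denominator \<open>?m\<close> is
      distributed to form the localized expectations.\<close>
    also have "\<dots> = ?B"
      unfolding T localized_expectation_def riem_inner_gradient_left
      by (simp add: add_divide_distrib real_sqrt_mult real_sqrt_divide mult_ac)
    also have "(\<integral>\<theta>. h (?a * (\<Phi> \<theta> - ?\<psi>)) \<partial>Post) = (\<integral>x. h x \<partial>distr Post borel Z)"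
      using integral_distr[OF Zm hm] by (simp add: Z_def)
    finally show "\<bar>(\<integral>x. h x \<partial>distr Post borel Z)
        - (\<integral>x. h x \<partial>density lborel (\<lambda>z. ennreal (normal_density 0 \<sigma> z)))\<bar> \<le> ?B" .
  qed
qed

end
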